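(* Let $n\geq1$, $\varepsilon>0$, and let $\psi:\mathbb{R}\to[0,\infty)$ satisfy $\psi\in C^2(\mathbb{R})$, $\psi(-y)=\psi(y)$, $\psi(0)=0$, $|\psi'(y)|\leq\nu_1$, $\psi(y)\geq\nu_2|y|-\nu_3$ and $\psi''(y)>0$ for all $y\in\mathbb{R}$, with constants $\nu_1,\nu_2>0$, $\nu_3\in\mathbb{R}$ (so $\psi$ is convex and increasing on $[0,\infty)$). Define $$F^*(p):=\sum_{i=1}^n\psi\Big(\sqrt[4]{\varepsilon^2+\sigma_i(p)^2}\Big),\quad p\in\mathbb{R}^{n\times n}.$$ Then $F^*$ is convex and of class $C^2$ on $\mathbb{R}^{n\times n}$.
   Context: For $p\in\mathbb{R}^{n\times n}$, $\sigma_1(p),\dots,\sigma_n(p)$ denote the eigenvalues of the symmetric positive semidefinite matrix $pp^T$ (counted with multiplicity). *)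

theory Defs
  imports "HOL-Analysis.Analysis" "HOL-Computational_Algebra.Polynomial"
begin

definition charpoly :: "real^'n^'n \<Rightarrow> real poly" where
  "charpoly A = det (\<chi> i j. (if i = j then [:0, 1:] else 0) - [:A $ i $ j:])"

text \<open>Eigenvalues of p p^T, counted with multiplicity (p p^T is symmetric PSD,
  so its characteristic polynomial splits over the reals).\<close>
definition sigmas :: "real^'n^'n \<Rightarrow> real multiset" where
  "sigmas p = proots (charpoly (p ** transpose p))"

definition Fstar :: "(real \<Rightarrow> real) \<Rightarrow> real \<Rightarrow> real^'n^'n \<Rightarrow> real" where
  "Fstar \<psi> \<epsilon> p = (\<Sum>s\<in>#sigmas p. \<psi> (root 4 (\<epsilon>^2 + s^2)))"

definition C2_on_UNIV :: "('a::euclidean_space \<Rightarrow> real) \<Rightarrow> bool" where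
  "C2_on_UNIV f \<longleftrightarrow> (\<exists>f' :: 'a \<Rightarrow> ('a \<Rightarrow>\<^sub>L real). \<exists>f'' :: 'a \<Rightarrow> ('a \<Rightarrow>\<^sub>L ('a \<Rightarrow>\<^sub>L real)).
     (\<forall>x. (f has_derivative blinfun_apply (f' x)) (at x)) \<and>
     (\<forall>x. (f' has_derivative blinfun_apply (f'' x)) (at x)) \<and>
     continuous_on UNIV f'')"

end

theory Submission
  imports Defs
begin

text \<open>Write \<open>F\<^sup>* p = tr f(p p\<^sup>T)\<close> with \<open>f s = \<psi> (root 4 (\<epsilon>\<^sup>2 + s\<^sup>2))\<close>, which is of class \<open>C\<^sup>2\<close> on the line.

  Regularity: comparing the eigenbases of two symmetric matrices shows that \<open>tr f\<close> has gradient
  \<open>f' A\<close> up to a quadratic error, and that a scalar function which is \<open>L\<close>-Lipschitz on the spectra acts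
  as an \<open>L\<close>-Lipschitz matrix function for the Frobenius norm. If polynomials \<open>q\<close> approximate \<open>f'\<close> in \<open>C\<^sup>1\<close>,
  then \<open>f' - q\<close> has a small Lipschitz constant, so the polynomial maps \<open>q (p p\<^sup>T)\<close> converge to
  \<open>f' (p p\<^sup>T)\<close> together with their derivatives, locally uniformly. No perturbation theory of eigenvalues is needed.

  Convexity: \<open>h t = f (t\<^sup>2)\<close> is even and convex, and \<open>F\<^sup>* p\<close> is the maximum of the convex functions
  \<open>\<Sum>i. h (u\<^sub>i \<bullet> p v\<^sub>i)\<close> over orthonormal bases \<open>u\<close> and orthogonal families \<open>v\<close> of vectors of norm
  at most 1.\<close>

section \<open>The spectral theorem\<close>

definition onb :: "('n \<Rightarrow> real^'n) \<Rightarrow> bool" where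
  "onb a \<longleftrightarrow> (\<forall>i j. a i \<bullet> a j = (if i = j then 1 else 0))"

definition eigsys :: "real^'n^'n \<Rightarrow> ('n \<Rightarrow> real^'n) \<Rightarrow> ('n \<Rightarrow> real) \<Rightarrow> bool" where
  "eigsys A a l \<longleftrightarrow> onb a \<and> (\<forall>i. A *v a i = l i *\<^sub>R a i)"

lemma symmetric_matrix_inner:
  fixes A :: "real^'n^'n"
  assumes "transpose A = A"
  shows "(A *v x) \<bullet> y = x \<bullet> (A *v y)"
  by (metis assms dot_lmul_matrix transpose_matrix_vector)

text \<open>A maximiser of the quadratic form on the unit sphere of an invariant subspace is an
  eigenvector.\<close>

lemma symmetric_matrix_eigenvector_in_subspace:
  fixes A :: "real^'n^'n"
  assumes sym: "transpose A = A" and U: "subspace U" and inv: "\<And>x. x \<in> U \<Longrightarrow> A *v x \<in> U"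
    and z: "z \<in> U" "z \<noteq> 0"
  obtains x l where "x \<in> U" "norm x = 1" "A *v x = l *\<^sub>R x"
proof -
  have "compact (U \<inter> sphere 0 1)"
    by (metis Int_commute closed_subspace[OF U] compact_Int_closed compact_sphere)
  moreover have "z /\<^sub>R norm z \<in> U \<inter> sphere 0 1"
    using z by (auto intro: subspace_scale[OF U])
  moreover have "continuous_on (U \<inter> sphere 0 1) (\<lambda>x. x \<bullet> (A *v x))"
    by (intro continuous_intros linear_continuous_on matrix_vector_mul_bounded_linear)
  ultimately have "\<exists>x\<in>U \<inter> sphere 0 1. \<forall>y\<in>U \<inter> sphere 0 1. y \<bullet> (A *v y) \<le> x \<bullet> (A *v x)"
    by (intro continuous_attains_sup) blast+
  then obtain x where x: "x \<in> U" "norm x = 1"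
    and max: "\<And>y. y \<in> U \<Longrightarrow> norm y = 1 \<Longrightarrow> y \<bullet> (A *v y) \<le> x \<bullet> (A *v x)"
    by auto
  define l where "l = x \<bullet> (A *v x)"
  define w where "w = A *v x - l *\<^sub>R x"
  have xx: "x \<bullet> x = 1" using x(2) by (simp add: norm_eq_1)
  have wU: "w \<in> U"
    unfolding w_def by (intro subspace_diff[OF U] subspace_scale[OF U] inv x)
  have wx: "w \<bullet> x = 0" "x \<bullet> w = 0"
    by (simp_all add: w_def l_def xx inner_diff_left inner_diff_right inner_commute)
  have "A *v x = w + l *\<^sub>R x" by (simp add: w_def)
  then have wAx: "w \<bullet> (A *v x) = w \<bullet> w" by (simp add: inner_add_right wx)
  have le: "y \<bullet> (A *v y) \<le> l * (y \<bullet> y)" if "y \<in> U" for y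
  proof (cases "y = 0")
    case False
    have "(y /\<^sub>R norm y) \<bullet> (A *v (y /\<^sub>R norm y)) \<le> l"
      unfolding l_def using False by (intro max subspace_scale[OF U] that) auto
    then show ?thesis
      using False by (simp add: matrix_vector_mult_scaleR field_simps power2_norm_eq_inner[symmetric] power2_eq_square)
  qed simp
  \<comment> \<open>Test maximality at \<open>x + t *\<^sub>R w\<close>. Since \<open>w\<close> is
    orthogonal to \<open>x\<close>, the residual enters at first order in \<open>t\<close>, while
    everything else is of second order.\<close>
  have bound: "2 * t * (w \<bullet> w) \<le> t\<^sup>2 * (l * (w \<bullet> w) - w \<bullet> (A *v w))" for t
  proof -
    have "(x + t *\<^sub>R w) \<bullet> (A *v (x + t *\<^sub>R w)) \<le> l * ((x + t *\<^sub>R w) \<bullet> (x + t *\<^sub>R w))"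
      by (intro le subspace_add[OF U] subspace_scale[OF U] x wU)
    moreover have "x \<bullet> (A *v w) = w \<bullet> w"
      using wAx symmetric_matrix_inner[OF sym, of x w] by (simp add: inner_commute)
    ultimately show ?thesis
      using wx wAx by (simp add: matrix_vector_mult_scaleR matrix_vector_right_distrib inner_add_left
          inner_add_right xx l_def[symmetric] algebra_simps power2_eq_square)
  qed
  have "w \<bullet> w \<le> 0"
  proof (rule ccontr)
    assume "\<not> w \<bullet> w \<le> 0"
    then have pos: "w \<bullet> w > 0" by linarith
    \<comment> \<open>The \<open>+ 1\<close> keeps \<open>K\<close> positive, and
      \<open>t = (w \<bullet> w) / K\<close> makes the quadratic side of \<open>bound\<close> half
      of the linear side, which contradicts it.\<close>
    define K where "K = \<bar>l * (w \<bullet> w) - w \<bullet> (A *v w)\<bar> + 1"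
    have K: "K > 0" "l * (w \<bullet> w) - w \<bullet> (A *v w) \<le> K" by (auto simp: K_def)
    define t where "t = (w \<bullet> w) / K"
    have t: "t > 0" "t * K = w \<bullet> w" using pos K by (auto simp: t_def)
    have "2 * t * (w \<bullet> w) \<le> t\<^sup>2 * K"
      using bound[of t] mult_left_mono[OF K(2), of "t\<^sup>2"] by auto
    also have "\<dots> = t * (w \<bullet> w)" using t by (simp add: power2_eq_square mult.assoc)
    finally show False using t pos by auto
  qed
  then have "w = 0" by (metis inner_ge_zero inner_eq_zero_iff order_antisym)
  then show thesis using that x by (simp add: w_def)
qed

text \<open>Induction on \<open>k\<close>: by symmetry the orthogonal complement of a set of
  eigenvectors is invariant, and it is nonzero as long as fewer than \<open>CARD('n)\<close> vectors
  have been found, so it contains a further eigenvector.\<close>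

lemma symmetric_matrix_orthonormal_eigenvectors:
  fixes A :: "real^'n^'n"
  assumes sym: "transpose A = A" and "k \<le> CARD('n)"
  shows "\<exists>S. finite S \<and> card S = k \<and> pairwise orthogonal S \<and> (\<forall>x\<in>S. norm x = 1 \<and> (\<exists>l. A *v x = l *\<^sub>R x))"
  using assms(2)
proof (induction k)
  case 0
  show ?case by (intro exI[of _ "{}"]) auto
next
  case (Suc k)
  then obtain S where S: "finite S" "card S = k" "pairwise orthogonal S"
    "\<And>x. x \<in> S \<Longrightarrow> norm x = 1" "\<And>x. x \<in> S \<Longrightarrow> \<exists>l. A *v x = l *\<^sub>R x" by auto
  define U where "U = {x. \<forall>s\<in>S. orthogonal x s}"
  have "dim (span S) < DIM(real^'n)"
    using Suc.prems S(1,2) dim_le_card'[of S] by simp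
  then obtain z where z: "z \<noteq> 0" "\<And>s. s \<in> span S \<Longrightarrow> orthogonal z s"
    using orthogonal_to_subspace_exists by (metis dim_span)
  have "subspace U" unfolding U_def
    by (auto simp: subspace_def orthogonal_def inner_add_left)
  moreover have "A *v x \<in> U" if "x \<in> U" for x
  proof -
    have "(A *v x) \<bullet> s = 0" if s: "s \<in> S" for s
    proof -
      obtain l where "A *v s = l *\<^sub>R s" using S(5) s by blast
      then show ?thesis
        using \<open>x \<in> U\<close> s by (simp add: symmetric_matrix_inner[OF sym] U_def orthogonal_def)
    qed
    then show ?thesis by (simp add: U_def orthogonal_def)
  qed
  moreover have "z \<in> U" using z(2) by (simp add: U_def span_base)
  ultimately obtain x l where x: "x \<in> U" "norm x = 1" "A *v x = l *\<^sub>R x"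
    using symmetric_matrix_eigenvector_in_subspace[OF sym] z(1) by metis
  have "x \<notin> S" using x by (auto simp: U_def orthogonal_def norm_eq_1)
  moreover have "pairwise orthogonal (insert x S)"
    using S(3) x(1) by (auto simp: pairwise_insert U_def orthogonal_commute)
  ultimately show ?case
    using S x by (intro exI[of _ "insert x S"]) auto
qed

theorem symmetric_matrix_eigsys:
  fixes A :: "real^'n^'n"
  assumes sym: "transpose A = A"
  obtains a l where "eigsys A a l"
proof -
  obtain S where S: "finite S" "card S = CARD('n)" "pairwise orthogonal S"
    "\<And>x. x \<in> S \<Longrightarrow> norm x = 1" "\<And>x. x \<in> S \<Longrightarrow> \<exists>l. A *v x = l *\<^sub>R x"
    using symmetric_matrix_orthonormal_eigenvectors[OF sym order_refl] by auto
  obtain a where a: "bij_betw a (UNIV :: 'n set) S"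
    using S(1,2) finite_same_card_bij[of "UNIV :: 'n set" S] by auto
  have aS: "a i \<in> S" for i using a by (auto simp: bij_betw_def)
  have "a i \<bullet> a j = (if i = j then 1 else 0)" for i j
    using S(3) S(4)[OF aS] aS a
    by (auto simp: pairwise_def orthogonal_def norm_eq_1 bij_betw_def inj_eq)
  then have "onb a" by (simp add: onb_def)
  moreover obtain l where "\<And>i. A *v a i = l i *\<^sub>R a i" using S(5)[OF aS] by metis
  ultimately have "eigsys A a l" by (simp add: eigsys_def)
  then show thesis by (rule that)
qed

section \<open>Orthonormal bases and the Frobenius inner product\<close>

lemma onb_expansion:
  assumes "onb a"
  shows "(\<Sum>i\<in>UNIV. (a i \<bullet> x) *\<^sub>R a i) = x"
proof -
  have o: "a i \<bullet> a j = (if i = j then 1 else 0)" for i j using assms by (simp add: onb_def)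
  have inj: "inj a" by (rule injI) (metis o zero_neq_one)
  have "independent (range a)"
  proof (rule pairwise_orthogonal_independent)
    show "pairwise orthogonal (range a)" by (auto simp: pairwise_def orthogonal_def o)
    show "0 \<notin> range a" by (metis imageE inner_zero_left o zero_neq_one)
  qed
  moreover have "card (range a) = DIM(real^'a)" using inj by (simp add: card_image)
  ultimately have span: "span (range a) = UNIV"
    using card_ge_dim_independent[of "range a" UNIV] by auto
  define d where "d = (\<Sum>i\<in>UNIV. (a i \<bullet> x) *\<^sub>R a i) - x"
  have "a j \<bullet> d = 0" for j
    by (simp add: d_def inner_diff_right inner_sum_right o if_distrib cong: if_cong)
  then have "orthogonal d y" if "y \<in> range a" for y using that by (auto simp: orthogonal_def inner_commute)
  then have "orthogonal d d" using orthogonal_to_span[of d "range a" d] span by (metis UNIV_I orthogonal_commute)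
  then show ?thesis by (simp add: d_def orthogonal_def)
qed

lemma onb_parseval_inner:
  assumes "onb a"
  shows "(\<Sum>i\<in>UNIV. (a i \<bullet> x) * (a i \<bullet> y)) = x \<bullet> y"
proof -
  have "x \<bullet> y = (\<Sum>i\<in>UNIV. (a i \<bullet> x) *\<^sub>R a i) \<bullet> y" by (simp add: onb_expansion[OF assms])
  then show ?thesis by (simp add: inner_sum_left)
qed

lemma onb_parseval:
  assumes "onb a"
  shows "(\<Sum>i\<in>UNIV. (a i \<bullet> x)\<^sup>2) = (norm x)\<^sup>2"
  using onb_parseval_inner[OF assms, of x x] by (simp add: power2_eq_square dot_square_norm)

text \<open>The inner product on matrices is the Frobenius one. Parseval applied to each pair of
  rows, followed by exchanging the sums, shows that any orthonormal basis computes it.\<close>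

lemma inner_matrix_onb:
  fixes M N :: "real^'n^'n"
  assumes "onb b"
  shows "(\<Sum>j\<in>UNIV. (M *v b j) \<bullet> (N *v b j)) = M \<bullet> N"
proof -
  have "M \<bullet> N = (\<Sum>r\<in>UNIV. \<Sum>j\<in>UNIV. (b j \<bullet> M $ r) * (b j \<bullet> N $ r))"
    by (simp add: onb_parseval_inner[OF assms] inner_vec_def[of M])
  also have "\<dots> = (\<Sum>j\<in>UNIV. \<Sum>r\<in>UNIV. (b j \<bullet> M $ r) * (b j \<bullet> N $ r))" by (rule sum.swap)
  also have "\<dots> = (\<Sum>j\<in>UNIV. (M *v b j) \<bullet> (N *v b j))"
    unfolding inner_vec_def[of "M *v _"] matrix_vector_mul_component by (simp add: inner_commute)
  finally show ?thesis by simp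
qed

text \<open>The bases on the two sides may differ; this allows the eigenbases of two different
  matrices to be used at once.\<close>

lemma norm_matrix_onb:
  fixes M :: "real^'n^'n"
  assumes "onb a" "onb b"
  shows "(\<Sum>i\<in>UNIV. \<Sum>j\<in>UNIV. (a i \<bullet> (M *v b j))\<^sup>2) = (norm M)\<^sup>2"
  by (subst sum.swap) (simp add: onb_parseval[OF assms(1)] inner_matrix_onb[OF assms(2)] power2_norm_eq_inner)

text \<open>Over the polynomial ring, the constant matrix \<open>Q\<close> of eigenvectors satisfies
  \<open>M ** Q = Q ** D\<close> with \<open>D\<close> diagonal. Its determinant squares to 1, so it
  can be cancelled.\<close>

lemma charpoly_eigsys:
  fixes A :: "real^'n^'n"
  assumes "eigsys A a l"
  shows "charpoly A = (\<Prod>i\<in>UNIV. [:- l i, 1:])"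
proof -
  have o: "a i \<bullet> a j = (if i = j then 1 else 0)" for i j using assms by (simp add: eigsys_def onb_def)
  define M :: "real poly^'n^'n" where "M = (\<chi> i j. (if i = j then [:0, 1:] else 0) - [:A $ i $ j:])"
  define Q :: "real poly^'n^'n" where "Q = (\<chi> i j. [:a j $ i:])"
  define D :: "real poly^'n^'n" where "D = (\<chi> i j. if i = j then [:- l i, 1:] else 0)"
  have sum_const: "(\<Sum>k\<in>K. [:c k:]) = [:\<Sum>k\<in>K. c k:]" for c :: "'n \<Rightarrow> real" and K
    by (induction K rule: infinite_finite_induct) auto
  have "transpose Q ** Q = mat 1"
    using o by (simp add: vec_eq_iff matrix_matrix_mult_def transpose_def Q_def mat_def sum_const
        inner_vec_def one_pCons)
  then have "det Q * det Q = 1"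
    by (metis det_I det_mul det_transpose)
  then have Q0: "det Q \<noteq> 0" by auto
  have "M ** Q = Q ** D"
  proof -
    have "(M ** Q) $ i $ j = (Q ** D) $ i $ j" for i j
    proof -
      have "(M ** Q) $ i $ j = (\<Sum>k\<in>UNIV. (if i = k then [:0, 1:] * [:a j $ k:] else 0) - [:A $ i $ k * a j $ k:])"
        unfolding matrix_matrix_mult_def M_def Q_def by (auto intro!: sum.cong simp: algebra_simps)
      also have "\<dots> = [:0, 1:] * [:a j $ i:] - [:(A *v a j) $ i:]"
        by (simp add: sum_subtractf sum_const matrix_vector_mult_def)
      also have "\<dots> = [:a j $ i:] * [:- l j, 1:]"
        using assms by (simp add: eigsys_def)
      also have "\<dots> = (Q ** D) $ i $ j"
        unfolding matrix_matrix_mult_def D_def Q_def by (simp add: if_distrib cong: if_cong)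
      finally show ?thesis .
    qed
    then show ?thesis by (simp add: vec_eq_iff)
  qed
  then have "det M * det Q = det Q * det D" by (metis det_mul)
  then have "det M = det D" using Q0 by simp
  also have "det D = (\<Prod>i\<in>UNIV. [:- l i, 1:])" by (subst det_diagonal) (auto simp: D_def)
  finally show ?thesis by (simp add: charpoly_def M_def)
qed

text \<open>Replaces the multiset of roots by an arbitrary eigensystem; the rest of the development
  reaches \<open>sigmas\<close> only through this identity.\<close>

lemma sum_sigmas_eigsys:
  fixes p :: "real^'n^'n"
  assumes "eigsys (p ** transpose p) a l"
  shows "(\<Sum>s\<in>#sigmas p. f s) = (\<Sum>i\<in>UNIV. f (l i))"
proof -
  have "sigmas p = (\<Sum>i\<in>UNIV. {#l i#})"
    unfolding sigmas_def charpoly_eigsys[OF assms] by (subst proots_prod) auto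
  then show ?thesis
    by (simp add: sum_unfold_sum_mset image_mset.compositionality o_def)
qed

section \<open>Functions of symmetric matrices\<close>

lemma matrix_eq_on_onb:
  fixes M N :: "real^'n^'n"
  assumes "onb b" and "\<And>j. M *v b j = N *v b j"
  shows "M = N"
proof -
  have "(M - N) \<bullet> (M - N) = 0"
    using assms by (simp add: inner_matrix_onb[OF assms(1), symmetric] matrix_vector_mult_diff_rdistrib)
  then show ?thesis by simp
qed

text \<open>For symmetric matrices the eigenvectors span, so the condition determines \<open>M\<close>; otherwise the value
  may be junk.\<close>

definition mfun :: "(real \<Rightarrow> real) \<Rightarrow> real^'n^'n \<Rightarrow> real^'n^'n" where
  "mfun g A = (SOME M. \<forall>v c. A *v v = c *\<^sub>R v \<longrightarrow> M *v v = g c *\<^sub>R v)"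

lemma mfun_eigenvector:
  fixes A :: "real^'n^'n"
  assumes sym: "transpose A = A" and "A *v v = c *\<^sub>R v"
  shows "mfun g A *v v = g c *\<^sub>R v"
proof -
  obtain a l where e: "eigsys A a l" using symmetric_matrix_eigsys[OF sym] .
  then have a: "onb a" by (simp add: eigsys_def)
  \<comment> \<open>The spectral sum of the rank one projections onto the \<open>a i\<close> with
    weights \<open>g (l i)\<close>; it witnesses the choice in \<open>mfun\<close>.\<close>
  define M where "M = (\<chi> r s. \<Sum>i\<in>UNIV. g (l i) * a i $ r * a i $ s)"
  have M: "M *v x = (\<Sum>i\<in>UNIV. g (l i) *\<^sub>R (a i \<bullet> x) *\<^sub>R a i)" for x
  proof -
    have "(M *v x) $ r = (\<Sum>i\<in>UNIV. g (l i) *\<^sub>R (a i \<bullet> x) *\<^sub>R a i) $ r" for r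
    proof -
      have "(M *v x) $ r = (\<Sum>s\<in>UNIV. \<Sum>i\<in>UNIV. g (l i) * a i $ r * a i $ s * x $ s)"
        by (simp add: matrix_vector_mult_def M_def sum_distrib_right)
      also have "\<dots> = (\<Sum>i\<in>UNIV. \<Sum>s\<in>UNIV. g (l i) * a i $ r * a i $ s * x $ s)" by (rule sum.swap)
      also have "\<dots> = (\<Sum>i\<in>UNIV. g (l i) *\<^sub>R (a i \<bullet> x) *\<^sub>R a i) $ r"
        by (simp add: inner_vec_def sum_distrib_left sum_distrib_right mult_ac)
      finally show ?thesis .
    qed
    then show ?thesis by (simp add: vec_eq_iff)
  qed
  have "\<forall>v c. A *v v = c *\<^sub>R v \<longrightarrow> M *v v = g c *\<^sub>R v"
  proof (intro allI impI)
    fix v c assume v: "A *v v = c *\<^sub>R v"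
    \<comment> \<open>By symmetry \<open>v\<close> has no component along \<open>a i\<close> unless
      \<open>l i = c\<close>.\<close>
    have "g (l i) *\<^sub>R (a i \<bullet> v) *\<^sub>R a i = g c *\<^sub>R (a i \<bullet> v) *\<^sub>R a i" for i
    proof -
      have "l i * (a i \<bullet> v) = c * (a i \<bullet> v)"
        using symmetric_matrix_inner[OF sym, of "a i" v] v e by (simp add: eigsys_def)
      then show ?thesis by auto
    qed
    then have "M *v v = (\<Sum>i\<in>UNIV. g c *\<^sub>R (a i \<bullet> v) *\<^sub>R a i)" unfolding M by (intro sum.cong refl)
    also have "\<dots> = g c *\<^sub>R v"
      by (simp add: scaleR_right.sum[symmetric] onb_expansion[OF a] del: scaleR_scaleR)
    finally show "M *v v = g c *\<^sub>R v" .
  qed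
  then have "\<forall>v c. A *v v = c *\<^sub>R v \<longrightarrow> mfun g A *v v = g c *\<^sub>R v"
    unfolding mfun_def by (rule someI)
  then show ?thesis using assms(2) by blast
qed

lemma eigsys_mfun:
  assumes "transpose A = A" "eigsys A a l"
  shows "mfun g A *v a i = g (l i) *\<^sub>R a i"
  using assms by (simp add: eigsys_def mfun_eigenvector)

lemma transpose_mfun:
  fixes A :: "real^'n^'n"
  assumes sym: "transpose A = A"
  shows "transpose (mfun g A) = mfun g A"
proof -
  obtain a l where e: "eigsys A a l" using symmetric_matrix_eigsys[OF sym] .
  then have a: "onb a" by (simp add: eigsys_def)
  have "transpose (mfun g A) *v a j = mfun g A *v a j" for j
  proof -
    have *: "a i \<bullet> (transpose (mfun g A) *v a j) = a i \<bullet> (mfun g A *v a j)" for i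
      using a by (simp add: inner_commute[of "a i"] dot_lmul_matrix eigsys_mfun[OF sym e] onb_def)
    show ?thesis
      by (subst (1 2) onb_expansion[OF a, symmetric]) (simp only: *)
  qed
  then show ?thesis by (rule matrix_eq_on_onb[OF a])
qed

text \<open>A Horner step, checked on an eigenbasis. It reduces polynomial matrix functions to sums
  and products, whose differentiability is elementary.\<close>

lemma mfun_poly_pCons:
  fixes A :: "real^'n^'n"
  assumes sym: "transpose A = A"
  shows "mfun (poly (pCons c q)) A = c *\<^sub>R mat 1 + A ** mfun (poly q) A"
proof -
  obtain a l where e: "eigsys A a l" using symmetric_matrix_eigsys[OF sym] .
  then have a: "onb a" "\<And>i. A *v a i = l i *\<^sub>R a i" by (auto simp: eigsys_def)
  show ?thesis
    by (rule matrix_eq_on_onb[OF a(1)])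
      (simp add: eigsys_mfun[OF sym e] matrix_vector_mult_add_rdistrib a(2) algebra_simps
        scaleR_matrix_vector_assoc[symmetric] matrix_vector_mul_assoc[symmetric] matrix_vector_mult_scaleR)
qed

lemma mfun_zero:
  fixes A :: "real^'n^'n"
  assumes sym: "transpose A = A"
  shows "mfun (\<lambda>_. 0) A = 0"
proof -
  obtain a l where e: "eigsys A a l" using symmetric_matrix_eigsys[OF sym] .
  then have a: "onb a" by (auto simp: eigsys_def)
  show ?thesis
    by (rule matrix_eq_on_onb[OF a]) (simp add: eigsys_mfun[OF sym e])
qed

lemma mfun_diff:
  fixes A :: "real^'n^'n"
  assumes sym: "transpose A = A"
  shows "mfun (\<lambda>x. g x - h x) A = mfun g A - mfun h A"
proof -
  obtain a l where e: "eigsys A a l" using symmetric_matrix_eigsys[OF sym] .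
  then have a: "onb a" by (auto simp: eigsys_def)
  show ?thesis
    by (rule matrix_eq_on_onb[OF a])
      (simp add: eigsys_mfun[OF sym e] matrix_vector_mult_diff_rdistrib algebra_simps)
qed

text \<open>Between the two eigenbases, \<open>A - B\<close> has the entries
  \<open>(l i - m j) * (a i \<bullet> b j)\<close> and the difference of the matrix functions has
  \<open>(g (l i) - g (m j)) * (a i \<bullet> b j)\<close>, so the scalar Lipschitz bound applies
  entry by entry.\<close>

lemma norm_mfun_diff_le:
  fixes A B :: "real^'n^'n"
  assumes symA: "transpose A = A" and symB: "transpose B = B"
    and eA: "eigsys A a l" and eB: "eigsys B b m"
    and S: "\<And>i. l i \<in> S" "\<And>j. m j \<in> S"
    and Lip: "\<And>x y. x \<in> S \<Longrightarrow> y \<in> S \<Longrightarrow> \<bar>g x - g y\<bar> \<le> L * \<bar>x - y\<bar>" and L: "L \<ge> 0"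
  shows "norm (mfun g A - mfun g B) \<le> L * norm (A - B)"
proof -
  have a: "onb a" and b: "onb b" and Aa: "\<And>i. A *v a i = l i *\<^sub>R a i" and Bb: "\<And>j. B *v b j = m j *\<^sub>R b j"
    using eA eB by (auto simp: eigsys_def)
  have 1: "a i \<bullet> ((mfun g A - mfun g B) *v b j) = (g (l i) - g (m j)) * (a i \<bullet> b j)" for i j
    by (simp add: matrix_vector_mult_diff_rdistrib inner_diff_right algebra_simps eigsys_mfun[OF symB eB]
        symmetric_matrix_inner[OF transpose_mfun[OF symA], symmetric] eigsys_mfun[OF symA eA])
  have 2: "a i \<bullet> ((A - B) *v b j) = (l i - m j) * (a i \<bullet> b j)" for i j
    by (simp add: matrix_vector_mult_diff_rdistrib inner_diff_right algebra_simps Bb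
        symmetric_matrix_inner[OF symA, symmetric] Aa)
  have "(norm (mfun g A - mfun g B))\<^sup>2 = (\<Sum>i\<in>UNIV. \<Sum>j\<in>UNIV. ((g (l i) - g (m j)) * (a i \<bullet> b j))\<^sup>2)"
    by (simp add: norm_matrix_onb[OF a b, symmetric] 1)
  also have "\<dots> \<le> (\<Sum>i\<in>UNIV. \<Sum>j\<in>UNIV. L\<^sup>2 * ((l i - m j) * (a i \<bullet> b j))\<^sup>2)"
  proof (intro sum_mono)
    fix i j
    have "\<bar>g (l i) - g (m j)\<bar> \<le> \<bar>L * (l i - m j)\<bar>" using Lip[OF S] L by (simp add: abs_mult)
    then have "(g (l i) - g (m j))\<^sup>2 \<le> (L * (l i - m j))\<^sup>2" by (rule abs_le_square_iff[THEN iffD1])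
    then show "((g (l i) - g (m j)) * (a i \<bullet> b j))\<^sup>2 \<le> L\<^sup>2 * ((l i - m j) * (a i \<bullet> b j))\<^sup>2"
      by (simp add: power_mult_distrib mult.assoc[symmetric] mult_right_mono)
  qed
  also have "\<dots> = (L * norm (A - B))\<^sup>2"
    by (simp add: norm_matrix_onb[OF a b, symmetric] 2 sum_distrib_left power_mult_distrib)
  finally show ?thesis using L by (simp add: power2_le_iff_abs_le)
qed

text \<open>Klein's argument: in the two eigenbases the second order Taylor remainder of the trace function is
  the average of the scalar remainders with respect to the doubly stochastic weights \<open>(a i \<bullet> b j)\<^sup>2\<close>.\<close>

lemma trace_function_taylor_bound:
  fixes A B :: "real^'n^'n"
  assumes symA: "transpose A = A" and symB: "transpose B = B"
    and eA: "eigsys A a l" and eB: "eigsys B b m"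
    and S: "\<And>i. l i \<in> S" "\<And>j. m j \<in> S"
    and T: "\<And>x y. x \<in> S \<Longrightarrow> y \<in> S \<Longrightarrow> \<bar>f y - f x - g x * (y - x)\<bar> \<le> C * (y - x)\<^sup>2"
  shows "\<bar>(\<Sum>j\<in>UNIV. f (m j)) - (\<Sum>i\<in>UNIV. f (l i)) - mfun g A \<bullet> (B - A)\<bar> \<le> C * (norm (B - A))\<^sup>2"
proof -
  have a: "onb a" and b: "onb b" and Aa: "\<And>i. A *v a i = l i *\<^sub>R a i" and Bb: "\<And>j. B *v b j = m j *\<^sub>R b j"
    using eA eB by (auto simp: eigsys_def)
  define w where "w i j = (a i \<bullet> b j)\<^sup>2" for i j
  have w1: "(\<Sum>i\<in>UNIV. w i j) = 1" for j
    using onb_parseval[OF a, of "b j"] b by (simp add: w_def power2_norm_eq_inner onb_def)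
  have w2: "(\<Sum>j\<in>UNIV. w i j) = 1" for i
    using onb_parseval[OF b, of "a i"] a by (simp add: w_def power2_norm_eq_inner onb_def inner_commute)
  have Bi: "a i \<bullet> (B *v a i) = (\<Sum>j\<in>UNIV. w i j * m j)" for i
    by (subst onb_parseval_inner[OF b, symmetric]) (simp add: symmetric_matrix_inner[OF symB, symmetric] Bb w_def power2_eq_square inner_commute mult_ac)
  have Ai: "a i \<bullet> (A *v a i) = (\<Sum>j\<in>UNIV. w i j * l i)" for i
    using a by (simp add: Aa sum_distrib_right[symmetric] w2 onb_def)
  have "mfun g A \<bullet> (B - A) = (\<Sum>i\<in>UNIV. \<Sum>j\<in>UNIV. w i j * (g (l i) * (m j - l i)))"
    by (simp add: inner_matrix_onb[OF a, symmetric] eigsys_mfun[OF symA eA] matrix_vector_mult_diff_rdistrib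
        inner_diff_right Bi Ai sum_subtractf[symmetric] sum_distrib_left algebra_simps)
  moreover have "(\<Sum>j\<in>UNIV. f (m j)) = (\<Sum>i\<in>UNIV. \<Sum>j\<in>UNIV. w i j * f (m j))"
    by (subst sum.swap) (simp add: sum_distrib_right[symmetric] w1)
  moreover have "(\<Sum>i\<in>UNIV. f (l i)) = (\<Sum>i\<in>UNIV. \<Sum>j\<in>UNIV. w i j * f (l i))"
    by (simp add: sum_distrib_right[symmetric] w2)
  ultimately have "(\<Sum>j\<in>UNIV. f (m j)) - (\<Sum>i\<in>UNIV. f (l i)) - mfun g A \<bullet> (B - A)
      = (\<Sum>i\<in>UNIV. \<Sum>j\<in>UNIV. w i j * (f (m j) - f (l i) - g (l i) * (m j - l i)))"
    by (simp add: sum_subtractf[symmetric] algebra_simps)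
  also have "\<bar>\<dots>\<bar> \<le> (\<Sum>i\<in>UNIV. \<Sum>j\<in>UNIV. w i j * (C * (m j - l i)\<^sup>2))"
    by (intro sum_abs[THEN order_trans] sum_mono)
       (simp add: abs_mult w_def mult_left_mono T S)
  also have "\<dots> = C * (\<Sum>i\<in>UNIV. \<Sum>j\<in>UNIV. (a i \<bullet> ((B - A) *v b j))\<^sup>2)"
    by (simp add: sum_distrib_left matrix_vector_mult_diff_rdistrib inner_diff_right Bb w_def
        symmetric_matrix_inner[OF symA, symmetric] Aa left_diff_distrib[symmetric] power_mult_distrib mult_ac)
  also have "\<dots> = C * (norm (B - A))\<^sup>2" by (simp add: norm_matrix_onb[OF a b])
  finally show ?thesis .
qed

section \<open>The spectrum of \<open>p ** transpose p\<close>\<close>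

lemma transpose_mult_transpose: "transpose (p ** transpose p) = p ** transpose (p :: real^'n^'n)"
  by (simp add: matrix_transpose_mul)

text \<open>Moving \<open>p\<close> across the inner product turns
  \<open>(a i v* p) \<bullet> (a j v* p)\<close> into \<open>a i\<close> against
  \<open>p ** transpose p\<close> applied to \<open>a j\<close>. The vectors \<open>a i v* p\<close>
  are the unnormalised right singular vectors.\<close>

lemma eigenvalue_mult_transpose:
  fixes p :: "real^'n^'n"
  assumes "eigsys (p ** transpose p) a l"
  shows "l i = (norm (a i v* p))\<^sup>2" "(a i v* p) \<bullet> (a j v* p) = (if i = j then l i else 0)"
proof -
  have "(a i v* p) \<bullet> (a j v* p) = (if i = j then l i else 0)" for i j
  proof -
    have "p *v (a j v* p) = (p ** transpose p) *v a j" by (simp add: matrix_vector_mul_assoc[symmetric])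
    also have "\<dots> = l j *\<^sub>R a j" using assms by (simp add: eigsys_def)
    finally show ?thesis using assms by (simp add: dot_lmul_matrix eigsys_def onb_def)
  qed
  from this this[of i i] show "l i = (norm (a i v* p))\<^sup>2" "(a i v* p) \<bullet> (a j v* p) = (if i = j then l i else 0)"
    by (auto simp: power2_norm_eq_inner)
qed

text \<open>The eigenvalue is one term of the sum that computes the squared Frobenius norm. A ball
  of matrices thus has its spectra in a compact interval, on which the scalar estimates are
  uniform.\<close>

lemma eigenvalue_mult_transpose_bounds:
  fixes p :: "real^'n^'n"
  assumes "eigsys (p ** transpose p) a l"
  shows "l i \<in> {0..(norm p)\<^sup>2}"
proof -
  have a: "onb a" using assms by (simp add: eigsys_def)
  have "l i = (norm (transpose p *v a i))\<^sup>2" by (simp add: eigenvalue_mult_transpose(1)[OF assms])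
  also have "\<dots> \<le> (\<Sum>j\<in>UNIV. (norm (transpose p *v a j))\<^sup>2)" by (rule member_le_sum) auto
  also have "\<dots> = (norm (transpose p))\<^sup>2" using inner_matrix_onb[OF a, of "transpose p" "transpose p"]
    by (simp add: power2_norm_eq_inner)
  also have "\<dots> = (norm p)\<^sup>2"
    unfolding power2_norm_eq_inner inner_vec_def inner_real_def transpose_def by (simp, rule sum.swap)
  finally show ?thesis by (simp add: eigenvalue_mult_transpose(1)[OF assms])
qed

section \<open>Limits of continuously differentiable maps\<close>

text \<open>Continuity of the derivative is only required pointwise, which in finite dimension is equivalent
  to continuity in the operator norm.\<close>

definition C1_map :: "('a::euclidean_space \<Rightarrow> 'b::euclidean_space) \<Rightarrow> bool" where
  "C1_map f \<longleftrightarrow> (\<exists>f'. (\<forall>x. (f has_derivative f' x) (at x)) \<and> (\<forall>h. continuous_on UNIV (\<lambda>x. f' x h)))"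

lemma C1_map_const: "C1_map (\<lambda>x. c)"
  unfolding C1_map_def by (intro exI[of _ "\<lambda>x h. 0"]) auto

lemma C1_map_bounded_linear:
  assumes "bounded_linear f"
  shows "C1_map f"
  unfolding C1_map_def
  by (intro exI[of _ "\<lambda>x. f"]) (auto intro: bounded_linear_imp_has_derivative assms)

lemma C1_map_add:
  assumes "C1_map f" "C1_map g"
  shows "C1_map (\<lambda>x. f x + g x)"
proof -
  obtain f' g' where "\<And>x. (f has_derivative f' x) (at x)" "\<And>h. continuous_on UNIV (\<lambda>x. f' x h)"
    "\<And>x. (g has_derivative g' x) (at x)" "\<And>h. continuous_on UNIV (\<lambda>x. g' x h)"
    using assms unfolding C1_map_def by blast
  then show ?thesis
    unfolding C1_map_def
    by (intro exI[of _ "\<lambda>x h. f' x h + g' x h"]) (auto intro!: has_derivative_add continuous_on_add)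
qed

lemma C1_map_bilinear:
  assumes B: "bounded_bilinear B" and "C1_map f" "C1_map g"
  shows "C1_map (\<lambda>x. B (f x) (g x))"
proof -
  obtain f' g' where f: "\<And>x. (f has_derivative f' x) (at x)" "\<And>h. continuous_on UNIV (\<lambda>x. f' x h)"
    and g: "\<And>x. (g has_derivative g' x) (at x)" "\<And>h. continuous_on UNIV (\<lambda>x. g' x h)"
    using assms unfolding C1_map_def by blast
  have "continuous_on UNIV f" "continuous_on UNIV g"
    using f(1) g(1) by (auto intro: continuous_at_imp_continuous_on has_derivative_continuous)
  then show ?thesis
    unfolding C1_map_def using f g
    by (intro exI[of _ "\<lambda>x h. B (f x) (g' x h) + B (f' x h) (g x)"])
      (auto intro!: continuous_on_add bounded_bilinear.FDERIV[OF B] bounded_bilinear.continuous_on[OF B])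
qed

text \<open>Compare the derivative with the increment along a short multiple of \<open>h\<close>.
  The bound lets Lipschitz estimates between approximants control the difference of their
  derivatives.\<close>

lemma norm_derivative_le_Lipschitz:
  fixes f :: "'a::real_normed_vector \<Rightarrow> 'b::real_normed_vector"
  assumes f: "(f has_derivative f') (at x)" and S: "open S" "x \<in> S"
    and Lip: "\<And>y. y \<in> S \<Longrightarrow> norm (f y - f x) \<le> L * norm (y - x)"
  shows "norm (f' h) \<le> L * norm h"
proof -
  \<comment> \<open>The slack \<open>e\<close> absorbs the differentiability error; it is sent to 0
    at the end.\<close>
  have "norm (f' h) \<le> (L + e) * norm h" if "e > 0" for e
  proof (cases "h = 0")
    case True
    then show ?thesis using f by (simp add: linear_simps(3) has_derivative_bounded_linear)
  next
    case False
    obtain d where d: "d > 0"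
      "\<And>y. norm (y - x) < d \<Longrightarrow> norm (f y - f x - f' (y - x)) \<le> e * norm (y - x)"
      using f \<open>e > 0\<close> unfolding has_derivative_at_alt by blast
    obtain r where r: "r > 0" "ball x r \<subseteq> S" using S openE by blast
    define t where "t = min d r / (2 * norm h)"
    have t: "t > 0" "norm (t *\<^sub>R h) < d" "norm (t *\<^sub>R h) < r"
      using d r False by (auto simp: t_def)
    have xS: "x + t *\<^sub>R h \<in> S" using r(2) t(3) by (auto simp: dist_norm)
    have "t * norm (f' h) = norm (f' (t *\<^sub>R h))"
      using f t(1) by (simp add: linear_simps(5) has_derivative_bounded_linear)
    also have "\<dots> \<le> norm (f (x + t *\<^sub>R h) - f x) + norm (f (x + t *\<^sub>R h) - f x - f' (t *\<^sub>R h))"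
      by (metis norm_triangle_sub norm_minus_commute)
    also have "\<dots> \<le> L * norm (t *\<^sub>R h) + e * norm (t *\<^sub>R h)"
      using Lip[OF xS] d(2)[of "x + t *\<^sub>R h"] t(2) by (intro add_mono) auto
    also have "\<dots> = t * ((L + e) * norm h)" using t(1) by (simp add: algebra_simps)
    finally show ?thesis using t(1) by simp
  qed
  note bound = this
  show ?thesis
  proof (cases "h = 0")
    case True
    then show ?thesis using bound[of 1] by simp
  next
    case False
    show ?thesis
    proof (rule field_le_epsilon)
      fix e :: real assume "e > 0"
      then show "norm (f' h) \<le> L * norm h + e"
        using bound[of "e / norm h"] False by (simp add: algebra_simps)
    qed
  qed
qed

text \<open>Two approximants differ by a map with a small Lipschitz constant, so their derivatives
  are uniformly Cauchy on the ball. The theorem on differentiating a limit then applies.\<close>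

lemma C1_map_local_limit:
  fixes f :: "'a::euclidean_space \<Rightarrow> 'b::euclidean_space"
  assumes approx: "\<And>e. e > 0 \<Longrightarrow> \<exists>g. C1_map g \<and>
      (\<forall>x\<in>ball 0 R. \<forall>y\<in>ball 0 R. norm ((f x - g x) - (f y - g y)) \<le> e * norm (x - y))"
    and R: "R > 0"
  obtains f' where "\<And>x. x \<in> ball 0 R \<Longrightarrow> (f has_derivative f' x) (at x)"
    "\<And>h. continuous_on (ball 0 R) (\<lambda>x. f' x h)"
proof -
  define e where "e n = 1 / real (Suc n)" for n
  have e0: "e n > 0" for n by (simp add: e_def)
  have elim: "e \<longlonglongrightarrow> 0" unfolding e_def by (rule LIMSEQ_Suc[OF lim_1_over_n])
  obtain g where gC: "\<And>n. C1_map (g n)" and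
    gL: "\<And>n x y. x \<in> ball 0 R \<Longrightarrow> y \<in> ball 0 R \<Longrightarrow>
      norm ((f x - g n x) - (f y - g n y)) \<le> e n * norm (x - y)"
    using approx[OF e0] by metis
  obtain g' where g': "\<And>n x. (g n has_derivative g' n x) (at x)"
    and g'c: "\<And>n h. continuous_on UNIV (\<lambda>x. g' n x h)"
    using gC unfolding C1_map_def by metis
  have cauchy: "norm (g' n x h - g' m x h) \<le> (e n + e m) * norm h" if x: "x \<in> ball 0 R" for n m x h
  proof (rule norm_derivative_le_Lipschitz)
    show "((\<lambda>x. g n x - g m x) has_derivative (\<lambda>h. g' n x h - g' m x h)) (at x)"
      by (intro has_derivative_diff g')
    show "norm (g n y - g m y - (g n x - g m x)) \<le> (e n + e m) * norm (y - x)" if "y \<in> ball 0 R" for y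
    proof -
      have "g n y - g m y - (g n x - g m x) = ((f y - g m y) - (f x - g m x)) - ((f y - g n y) - (f x - g n x))"
        by simp
      also have "norm \<dots> \<le> e m * norm (y - x) + e n * norm (y - x)"
        by (intro norm_triangle_le_diff add_mono gL x that)
      finally show ?thesis by (simp add: algebra_simps)
    qed
  qed (use x in auto)
  define f' where "f' x h = lim (\<lambda>n. g' n x h)" for x h
  have lim: "(\<lambda>n. g' n x h) \<longlonglongrightarrow> f' x h" if x: "x \<in> ball 0 R" for x h
  proof -
    have "Cauchy (\<lambda>n. g' n x h)"
    proof (rule metric_CauchyI)
      fix \<epsilon> :: real assume "\<epsilon> > 0"
      moreover have "(\<lambda>n. e n * norm h) \<longlonglongrightarrow> 0" using tendsto_mult_left_zero[OF elim] .
      ultimately have "\<forall>\<^sub>F n in sequentially. e n * norm h < \<epsilon> / 2"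
        by (intro order_tendstoD(2)) auto
      then obtain N where N: "\<And>n. n \<ge> N \<Longrightarrow> e n * norm h < \<epsilon> / 2"
        by (auto simp: eventually_sequentially)
      have "dist (g' m x h) (g' n x h) < \<epsilon>" if "m \<ge> N" "n \<ge> N" for m n
        using cauchy[OF x, of m h n] N[OF that(1)] N[OF that(2)] by (simp add: dist_norm algebra_simps)
      then show "\<exists>N. \<forall>m\<ge>N. \<forall>n\<ge>N. dist (g' m x h) (g' n x h) < \<epsilon>" by blast
    qed
    then show ?thesis unfolding f'_def by (simp add: Cauchy_convergent convergent_LIMSEQ_iff[symmetric])
  qed
  have unif: "norm (g' n x h - f' x h) \<le> e n * norm h" if x: "x \<in> ball 0 R" for n x h
  \<comment> \<open>Let \<open>m\<close> tend to infinity in \<open>cauchy\<close>; the term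
    \<open>e m * norm h\<close> is moved to the left so that the right side does not depend on
    \<open>m\<close>.\<close>
  proof (rule Lim_bounded)
    have "(\<lambda>m. norm (g' n x h - g' m x h) - e m * norm h) \<longlonglongrightarrow> norm (g' n x h - f' x h) - 0 * norm h"
      by (intro tendsto_intros lim x elim)
    then show "(\<lambda>m. norm (g' n x h - g' m x h) - e m * norm h) \<longlonglongrightarrow> norm (g' n x h - f' x h)" by simp
    show "\<forall>m\<ge>0. norm (g' n x h - g' m x h) - e m * norm h \<le> e n * norm h"
      using cauchy[OF x, of n h] by (simp add: algebra_simps)
  qed
  have ev: "\<forall>\<^sub>F n in sequentially. \<forall>x\<in>ball 0 R. \<forall>h. norm (g' n x h - f' x h) \<le> \<epsilon> * norm h"
    if "\<epsilon> > 0" for \<epsilon>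
  proof -
    have "\<forall>\<^sub>F n in sequentially. e n < \<epsilon>" using order_tendstoD(2)[OF elim that] .
    then show ?thesis
    proof eventually_elim
      case (elim n)
      then show ?case using unif by (meson less_imp_le mult_right_mono norm_ge_zero order_trans)
    qed
  qed
  \<comment> \<open>The approximants are close to \<open>f\<close> only up to additive constants;
    the shift makes them agree with \<open>f\<close> at 0.\<close>
  have "\<exists>k. \<forall>x\<in>ball 0 R. (\<lambda>n. g n x + (f 0 - g n 0)) \<longlonglongrightarrow> k x \<and> (k has_derivative f' x) (at x within ball 0 R)"
  proof (rule has_derivative_sequence[OF convex_ball _ ev])
    show "((\<lambda>x. g n x + (f 0 - g n 0)) has_derivative g' n x) (at x within ball 0 R)" for n x
      using has_derivative_add[OF g' has_derivative_const] by (auto intro: has_derivative_at_withinI)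
    show "(\<lambda>n. g n 0 + (f 0 - g n 0)) \<longlonglongrightarrow> f 0" by simp
  qed (use R in auto)
  then obtain k where k: "\<And>x. x \<in> ball 0 R \<Longrightarrow> (\<lambda>n. g n x + (f 0 - g n 0)) \<longlonglongrightarrow> k x"
    "\<And>x. x \<in> ball 0 R \<Longrightarrow> (k has_derivative f' x) (at x within ball 0 R)" by blast
  have kf: "k x = f x" if x: "x \<in> ball 0 R" for x
  proof -
    have "(\<lambda>n. g n x + (f 0 - g n 0)) \<longlonglongrightarrow> f x"
    proof (rule Lim_transform_bound[of "\<lambda>n. g n x + (f 0 - g n 0) - f x" "\<lambda>n. e n * norm x", THEN LIM_zero_cancel])
      show "\<forall>\<^sub>F n in sequentially. norm (g n x + (f 0 - g n 0) - f x) \<le> norm (e n * norm x)"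
      proof (intro always_eventually allI)
        fix n
        have "norm (g n x + (f 0 - g n 0) - f x) = norm ((f x - g n x) - (f 0 - g n 0))"
          by (metis norm_minus_commute add_diff_eq diff_diff_eq2 diff_add_eq add.commute)
        also have "\<dots> \<le> e n * norm x" using gL[of x 0 n] x R by auto
        finally show "norm (g n x + (f 0 - g n 0) - f x) \<le> norm (e n * norm x)" using e0[of n] by (simp add: abs_mult)
      qed
      show "(\<lambda>n. e n * norm x) \<longlonglongrightarrow> 0" using tendsto_mult_left_zero[OF elim] .
    qed
    then show ?thesis using k(1)[OF x] LIMSEQ_unique by blast
  qed
  show thesis
  proof (rule that[of f'])
    fix x :: 'a assume x: "x \<in> ball 0 R"
    have "(k has_derivative f' x) (at x)" using k(2)[OF x] at_within_open[OF x open_ball] by simp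
    then show "(f has_derivative f' x) (at x)"
      using kf by (rule has_derivative_transform_within_open[OF _ open_ball x])
  next
    fix h
    show "continuous_on (ball 0 R) (\<lambda>x. f' x h)"
    proof (rule uniform_limit_theorem[of _ "\<lambda>n x. g' n x h" sequentially])
      show "uniform_limit (ball 0 R) (\<lambda>n x. g' n x h) (\<lambda>x. f' x h) sequentially"
      proof (rule uniform_limitI)
        fix \<epsilon> :: real assume "\<epsilon> > 0"
        then have "\<forall>\<^sub>F n in sequentially. e n * norm h < \<epsilon>"
          using order_tendstoD(2)[OF tendsto_mult_left_zero[OF elim]] by blast
        then show "\<forall>\<^sub>F n in sequentially. \<forall>x\<in>ball 0 R. dist (g' n x h) (f' x h) < \<epsilon>"
          by eventually_elim (auto simp: dist_norm intro: le_less_trans[OF unif])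
      qed
    qed (auto intro!: always_eventually continuous_on_subset[OF g'c])
  qed
qed

text \<open>The approximants may depend on the radius. Uniqueness of the derivative makes the local
  derivatives agree, so \<open>frechet_derivative\<close> serves as a global one.\<close>

lemma C1_map_limit:
  fixes f :: "'a::euclidean_space \<Rightarrow> 'b::euclidean_space"
  assumes approx: "\<And>R e. R > 0 \<Longrightarrow> e > 0 \<Longrightarrow> \<exists>g. C1_map g \<and>
      (\<forall>x\<in>ball 0 R. \<forall>y\<in>ball 0 R. norm ((f x - g x) - (f y - g y)) \<le> e * norm (x - y))"
  shows "C1_map f"
proof -
  define f' where "f' x = frechet_derivative f (at x)" for x
  have "(f has_derivative f' x) (at x) \<and> (\<forall>h. continuous (at x) (\<lambda>y. f' y h))" for x
  proof -
    have R: "norm x + 1 > 0" by (simp add: add_nonneg_pos)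
    obtain D where D: "\<And>y. y \<in> ball 0 (norm x + 1) \<Longrightarrow> (f has_derivative D y) (at y)"
      "\<And>h. continuous_on (ball 0 (norm x + 1)) (\<lambda>y. D y h)"
      using C1_map_local_limit[OF approx R] R by metis
    have eq: "f' y = D y" if "y \<in> ball 0 (norm x + 1)" for y
      unfolding f'_def using frechet_derivative_at[OF D(1)[OF that]] by simp
    have x: "x \<in> ball 0 (norm x + 1)" by simp
    have "continuous_on (ball 0 (norm x + 1)) (\<lambda>y. f' y h)" for h
      using D(2)[of h] by (rule continuous_on_eq) (simp add: eq)
    then show ?thesis
      using D(1)[OF x] eq[OF x] continuous_on_interior[of "ball 0 (norm x + 1)" _ x] x
      by (auto simp: interior_open)
  qed
  then show ?thesis
    unfolding C1_map_def by (intro exI[of _ f']) (auto intro: continuous_at_imp_continuous_on)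
qed

text \<open>Sending a vector to the functional it represents is bounded linear, which carries the
  derivative of the gradient to one of \<open>f'\<close>. Continuity in operator norm is checked on
  basis vectors.\<close>

lemma C2_on_UNIV_gradient:
  fixes f :: "'a::euclidean_space \<Rightarrow> real"
  assumes d: "\<And>x. (f has_derivative (\<lambda>h. G x \<bullet> h)) (at x)" and "C1_map G"
  shows "C2_on_UNIV f"
proof -
  obtain G' where G': "\<And>x. (G has_derivative G' x) (at x)" and c: "\<And>h. continuous_on UNIV (\<lambda>x. G' x h)"
    using assms(2) unfolding C1_map_def by blast
  have bl: "bounded_linear (\<lambda>h. blinfun_inner_right (G' x h))" for x
    using bounded_linear_compose[OF bounded_linear_blinfun_inner_right has_derivative_bounded_linear[OF G']] .
  define f'' where "f'' x = Blinfun (\<lambda>h. blinfun_inner_right (G' x h))" for x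
  have f'': "blinfun_apply (f'' x) = (\<lambda>h. blinfun_inner_right (G' x h))" for x
    unfolding f''_def using bl by (rule bounded_linear_Blinfun_apply)
  have "continuous_on UNIV f''"
  proof (rule continuous_on_blinfun_componentwise)
    fix i :: 'a
    show "continuous_on UNIV (\<lambda>x. blinfun_apply (f'' x) i)"
      unfolding f'' by (rule bounded_linear.continuous_on[OF bounded_linear_blinfun_inner_right c])
  qed
  moreover have "((\<lambda>x. blinfun_inner_right (G x)) has_derivative blinfun_apply (f'' x)) (at x)" for x
    unfolding f'' by (rule bounded_linear.has_derivative[OF bounded_linear_blinfun_inner_right G'])
  moreover have "(f has_derivative blinfun_apply (blinfun_inner_right (G x))) (at x)" for x
    using d[of x] by simp
  ultimately show ?thesis
    unfolding C2_on_UNIV_def by (intro exI[of _ "\<lambda>x. blinfun_inner_right (G x)"] exI[of _ f'']) auto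
qed

section \<open>Regularity of spectral functions\<close>

lemma bounded_bilinear_matrix_mult:
  "bounded_bilinear ((**) :: real^'n^'n \<Rightarrow> real^'n^'n \<Rightarrow> real^'n^'n)"
  unfolding bilinear_conv_bounded_bilinear[symmetric] bilinear_def
  by (auto intro!: linearI simp: matrix_matrix_mult_def vec_eq_iff sum.distrib sum_distrib_left algebra_simps)

lemma bounded_linear_transpose:
  "bounded_linear (transpose :: real^'n^'n \<Rightarrow> real^'n^'n)"
  unfolding linear_conv_bounded_linear[symmetric]
  by (auto intro!: linearI simp: transpose_def vec_eq_iff)

lemma C1_map_mult_transpose: "C1_map (\<lambda>p :: real^'n^'n. p ** transpose p)"
  by (rule C1_map_bilinear[OF bounded_bilinear_matrix_mult C1_map_bounded_linear C1_map_bounded_linear])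
    (rule bounded_linear_ident bounded_linear_transpose)+

lemma mult_transpose_Lipschitz:
  obtains K where "K \<ge> 0"
    "\<And>p q :: real^'n^'n. p \<in> ball 0 R \<Longrightarrow> q \<in> ball 0 R \<Longrightarrow>
      norm (p ** transpose p - q ** transpose q) \<le> K * norm (p - q)"
proof -
  let ?B = "\<lambda>(p :: real^'n^'n) (q :: real^'n^'n). p ** transpose q"
  interpret B: bounded_bilinear ?B
    by (rule bounded_bilinear.comp[OF bounded_bilinear_matrix_mult bounded_linear_ident bounded_linear_transpose])
  obtain K where K: "K > 0" "\<And>p q. norm (?B p q) \<le> norm p * norm q * K" using B.pos_bounded by blast
  have "norm (?B p p - ?B q q) \<le> (2 * \<bar>R\<bar> * K) * norm (p - q)" if "p \<in> ball 0 R" "q \<in> ball 0 R" for p q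
  proof -
    \<comment> \<open>Telescoping the quadratic map leaves the factor \<open>p - q\<close> in each
      term.\<close>
    have "?B p p - ?B q q = ?B (p - q) p + ?B q (p - q)" by (simp only: B.diff_left B.diff_right) simp
    also have "norm \<dots> \<le> norm (p - q) * norm p * K + norm q * norm (p - q) * K"
      by (intro norm_triangle_le add_mono K)
    also have "\<dots> \<le> norm (p - q) * \<bar>R\<bar> * K + \<bar>R\<bar> * norm (p - q) * K"
      using that K(1) by (intro add_mono mult_right_mono mult_left_mono) auto
    finally show ?thesis by (simp add: algebra_simps)
  qed
  then show thesis using that[of "2 * \<bar>R\<bar> * K"] K(1) by simp
qed

section \<open>Polynomial approximation together with the derivative\<close>

lemma antiderivative_poly:
  assumes "real_polynomial_function r"
  obtains q where "\<And>x. (poly q has_real_derivative r x) (at x)"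
proof -
  obtain a n where r: "r = (\<lambda>x. \<Sum>i\<le>n. a i * x ^ i)"
    using assms unfolding real_polynomial_function_iff_sum by blast
  define q where "q = (\<Sum>i\<le>n. monom (a i / real (Suc i)) (Suc i))"
  have "poly q = (\<lambda>x. \<Sum>i\<le>n. a i / real (Suc i) * x ^ Suc i)"
    by (rule ext) (simp only: q_def poly_sum poly_monom)
  moreover have "((\<lambda>x. \<Sum>i\<le>n. a i / real (Suc i) * x ^ Suc i) has_real_derivative r x) (at x)" for x
    unfolding r by (auto intro!: derivative_eq_intros simp: mult.commute simp del: power_Suc)
  ultimately show thesis using that[of q] by simp
qed

text \<open>Approximate the derivative \<open>g'\<close> uniformly by Stone-Weierstrass and
  integrate the polynomial; the mean value inequality then bounds the increments of
  \<open>g - poly q\<close>.\<close>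

lemma poly_approx_Lipschitz:
  fixes g g' :: "real \<Rightarrow> real"
  assumes g: "\<And>x. (g has_real_derivative g' x) (at x)" and c: "continuous_on UNIV g'" and e: "e > 0"
  obtains q where "\<And>x y. x \<in> {u..v} \<Longrightarrow> y \<in> {u..v} \<Longrightarrow>
    \<bar>(g x - poly q x) - (g y - poly q y)\<bar> \<le> e * \<bar>x - y\<bar>"
proof -
  obtain r where r: "real_polynomial_function r" "\<And>x. x \<in> {u..v} \<Longrightarrow> \<bar>g' x - r x\<bar> < e"
    using Stone_Weierstrass_real_polynomial_function[OF compact_Icc continuous_on_subset[OF c] e] by blast
  obtain q where q: "\<And>x. (poly q has_real_derivative r x) (at x)" using antiderivative_poly[OF r(1)] by blast
  have "norm ((g x - poly q x) - (g y - poly q y)) \<le> e * norm (x - y)"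
    if "x \<in> {u..v}" "y \<in> {u..v}" for x y
  proof (rule field_differentiable_bound[where f' = "\<lambda>x. g' x - r x" and S = "{u..v}"])
    show "((\<lambda>x. g x - poly q x) has_real_derivative g' z - r z) (at z within {u..v})" for z
      by (intro DERIV_diff DERIV_subset[OF g] DERIV_subset[OF q]) auto
    show "norm (g' z - r z) \<le> e" if "z \<in> {u..v}" for z using r(2)[OF that] by simp
  qed (use that in auto)
  then show thesis using that[of q] by simp
qed

lemma C1_map_mfun_poly: "C1_map (\<lambda>p :: real^'n^'n. mfun (poly q) (p ** transpose p))"
proof (induction q)
  case 0
  show ?case by (simp add: mfun_zero transpose_mult_transpose C1_map_const poly_0[abs_def])
next
  case (pCons c q)
  show ?case
    unfolding mfun_poly_pCons[OF transpose_mult_transpose]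
    by (rule C1_map_add[OF C1_map_const C1_map_bilinear[OF bounded_bilinear_matrix_mult
        C1_map_mult_transpose pCons.IH]])
qed

lemma norm_mfun_mult_transpose_diff_le:
  fixes p q :: "real^'n^'n"
  assumes "p \<in> ball 0 R" "q \<in> ball 0 R"
    and "\<And>x y. x \<in> {0..R\<^sup>2} \<Longrightarrow> y \<in> {0..R\<^sup>2} \<Longrightarrow> \<bar>g x - g y\<bar> \<le> L * \<bar>x - y\<bar>" and "L \<ge> 0"
  shows "norm (mfun g (p ** transpose p) - mfun g (q ** transpose q)) \<le> L * norm (p ** transpose p - q ** transpose q)"
proof -
  obtain a l where a: "eigsys (p ** transpose p) a l" using symmetric_matrix_eigsys[OF transpose_mult_transpose] .
  obtain b m where b: "eigsys (q ** transpose q) b m" using symmetric_matrix_eigsys[OF transpose_mult_transpose] .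
  have "(norm p)\<^sup>2 \<le> R\<^sup>2" "(norm q)\<^sup>2 \<le> R\<^sup>2" using assms(1,2) by (auto intro: power_mono)
  then have "l i \<in> {0..R\<^sup>2}" "m i \<in> {0..R\<^sup>2}" for i
    using eigenvalue_mult_transpose_bounds[OF a, of i] eigenvalue_mult_transpose_bounds[OF b, of i] by auto
  then show ?thesis
    using norm_mfun_diff_le[OF transpose_mult_transpose transpose_mult_transpose a b _ _ assms(3,4)] by blast
qed

text \<open>\<open>g - poly q\<close> is \<open>d\<close>-Lipschitz on the interval containing the
  spectra, hence so is its matrix function, and \<open>p ** transpose p\<close> is
  \<open>K\<close>-Lipschitz on the ball. The polynomial maps therefore approximate in the sense of
  \<open>C1_map_limit\<close>.\<close>

lemma C1_map_mfun:
  fixes g g' :: "real \<Rightarrow> real"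
  assumes g: "\<And>x. (g has_real_derivative g' x) (at x)" and c: "continuous_on UNIV g'"
  shows "C1_map (\<lambda>p :: real^'n^'n. mfun g (p ** transpose p))"
proof (rule C1_map_limit)
  fix R e :: real assume R: "R > 0" and e: "e > 0"
  obtain K where K: "K \<ge> 0" "\<And>p q :: real^'n^'n. p \<in> ball 0 R \<Longrightarrow> q \<in> ball 0 R \<Longrightarrow>
      norm (p ** transpose p - q ** transpose q) \<le> K * norm (p - q)"
    using mult_transpose_Lipschitz by blast
  define d where "d = e / (K + 1)"
  have d: "d > 0" "d * K \<le> e" using e K(1) by (auto simp: d_def field_simps)
  obtain q where q: "\<And>x y. x \<in> {0..R\<^sup>2} \<Longrightarrow> y \<in> {0..R\<^sup>2} \<Longrightarrow>
      \<bar>(g x - poly q x) - (g y - poly q y)\<bar> \<le> d * \<bar>x - y\<bar>"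
    using poly_approx_Lipschitz[OF g c d(1)] by blast
  let ?P = "\<lambda>p :: real^'n^'n. mfun (poly q) (p ** transpose p)"
  have "norm ((mfun g (x ** transpose x) - ?P x) - (mfun g (y ** transpose y) - ?P y)) \<le> e * norm (x - y)"
    if xy: "x \<in> ball 0 R" "y \<in> ball 0 R" for x y :: "real^'n^'n"
  proof -
    have "norm ((mfun g (x ** transpose x) - ?P x) - (mfun g (y ** transpose y) - ?P y))
        \<le> d * norm (x ** transpose x - y ** transpose y)"
      using norm_mfun_mult_transpose_diff_le[OF xy q] d(1)
      by (simp add: mfun_diff[OF transpose_mult_transpose])
    also have "\<dots> \<le> d * (K * norm (x - y))" using d(1) by (intro mult_left_mono K(2) xy) auto
    also have "\<dots> \<le> e * norm (x - y)"
      unfolding mult.assoc[symmetric] by (intro mult_right_mono d) auto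
    finally show ?thesis .
  qed
  then show "\<exists>h. C1_map h \<and> (\<forall>x :: real^'n^'n \<in>ball 0 R. \<forall>y :: real^'n^'n \<in>ball 0 R.
      norm ((mfun g (x ** transpose x) - h x) - (mfun g (y ** transpose y) - h y)) \<le> e * norm (x - y))"
    by (intro exI[of _ ?P] conjI ballI C1_map_mfun_poly)
qed

text \<open>The mean value inequality is applied twice: to \<open>g\<close> with a bound on
  \<open>g'\<close>, and then to \<open>f\<close> minus its linear part of slope
  \<open>g x\<close>.\<close>

lemma taylor_quadratic_bound:
  fixes f g g' :: "real \<Rightarrow> real"
  assumes f: "\<And>x. (f has_real_derivative g x) (at x)" and g: "\<And>x. (g has_real_derivative g' x) (at x)"
    and c: "continuous_on UNIV g'"
  obtains C where "C \<ge> 0" "\<And>x y. x \<in> {u..v} \<Longrightarrow> y \<in> {u..v} \<Longrightarrow> \<bar>f y - f x - g x * (y - x)\<bar> \<le> C * (y - x)\<^sup>2"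
proof -
  have "bounded (g' ` {u..v})"
    by (intro compact_imp_bounded compact_continuous_image continuous_on_subset[OF c]) auto
  then obtain C where C: "C > 0" "\<And>x. x \<in> {u..v} \<Longrightarrow> \<bar>g' x\<bar> \<le> C"
    unfolding bounded_pos by auto
  have "\<bar>f y - f x - g x * (y - x)\<bar> \<le> C * (y - x)\<^sup>2" if xy: "x \<in> {u..v}" "y \<in> {u..v}" for x y
  proof -
    have seg: "closed_segment x y \<subseteq> {u..v}" using xy by (simp add: closed_segment_subset)
    have "norm ((f y - g x * y) - (f x - g x * x)) \<le> (C * \<bar>y - x\<bar>) * norm (y - x)"
    proof (rule field_differentiable_bound[where f' = "\<lambda>z. g z - g x" and S = "closed_segment x y"])
      show "((\<lambda>z. f z - g x * z) has_real_derivative g z - g x) (at z within closed_segment x y)" for z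
        by (rule DERIV_subset[of _ _ _ UNIV]) (auto intro!: derivative_eq_intros f)
      show "norm (g z - g x) \<le> C * \<bar>y - x\<bar>" if z: "z \<in> closed_segment x y" for z
      proof -
        have "norm (g z - g x) \<le> C * norm (z - x)"
          by (rule field_differentiable_bound[where f' = g' and S = "{u..v}"])
            (use C z seg xy in \<open>auto intro: DERIV_subset[OF g]\<close>)
        also have "\<dots> \<le> C * \<bar>y - x\<bar>" using C(1) segment_bound(1)[OF z] by (simp add: abs_minus_commute)
        finally show ?thesis .
      qed
    qed auto
    moreover have "(f y - g x * y) - (f x - g x * x) = f y - f x - g x * (y - x)" by (simp add: algebra_simps)
    moreover have "(C * \<bar>y - x\<bar>) * \<bar>y - x\<bar> = C * (y - x)\<^sup>2"
      by (metis mult.assoc abs_mult_self_eq power2_eq_square)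
    ultimately show ?thesis by simp
  qed
  then show thesis using that[of C] C(1) by simp
qed

lemma has_derivative_zero_quadratic:
  fixes r :: "'a::real_normed_vector \<Rightarrow> real"
  assumes "open S" "x \<in> S" and bound: "\<And>y. y \<in> S \<Longrightarrow> \<bar>r y - r x\<bar> \<le> C * (norm (y - x))\<^sup>2" and C: "C \<ge> 0"
  shows "(r has_derivative (\<lambda>h. 0)) (at x)"
  unfolding has_derivative_at_alt
proof (intro conjI allI impI bounded_linear_zero)
  fix e :: real assume e: "e > 0"
  obtain d where d: "d > 0" "ball x d \<subseteq> S" using assms(1,2) openE by blast
  define \<delta> where "\<delta> = min d (e / (C + 1))"
  have "norm (r y - r x - 0) \<le> e * norm (y - x)" if y: "norm (y - x) < \<delta>" for y
  proof -
    have "y \<in> S" using d y by (auto simp: \<delta>_def dist_norm norm_minus_commute)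
    then have "\<bar>r y - r x\<bar> \<le> (C * norm (y - x)) * norm (y - x)"
      using bound by (simp add: power2_eq_square mult.assoc)
    also have "\<dots> \<le> e * norm (y - x)"
    proof (rule mult_right_mono)
      have "norm (y - x) * (C + 1) \<le> e" using y C by (simp add: \<delta>_def pos_less_divide_eq)
      then show "C * norm (y - x) \<le> e" by (simp add: algebra_simps) (smt (verit) norm_ge_zero)
    qed simp
    finally show ?thesis by simp
  qed
  moreover have "\<delta> > 0" using d e C by (simp add: \<delta>_def)
  ultimately show "\<exists>d>0. \<forall>y. norm (y - x) < d \<longrightarrow> norm (r y - r x - 0) \<le> e * norm (y - x)" by blast
qed

text \<open>Right multiplication by \<open>p\<close> is the adjoint of right multiplication by
  \<open>transpose p\<close>; this is how the gradient is read off.\<close>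

lemma inner_matrix_mult_transpose:
  fixes M h p :: "real^'n^'n"
  shows "M \<bullet> (h ** transpose p) = (M ** p) \<bullet> h"
proof -
  have "M \<bullet> (h ** transpose p) = (\<Sum>i\<in>UNIV. \<Sum>j\<in>UNIV. \<Sum>k\<in>UNIV. M $ i $ j * h $ i $ k * p $ j $ k)"
    by (simp add: inner_vec_def matrix_matrix_mult_def transpose_def sum_distrib_left mult_ac)
  also have "\<dots> = (\<Sum>i\<in>UNIV. \<Sum>k\<in>UNIV. \<Sum>j\<in>UNIV. M $ i $ j * h $ i $ k * p $ j $ k)"
    by (intro sum.cong refl sum.swap)
  also have "\<dots> = (M ** p) \<bullet> h"
    by (simp add: inner_vec_def matrix_matrix_mult_def sum_distrib_left sum_distrib_right mult_ac)
  finally show ?thesis .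
qed

lemma inner_transpose:
  fixes M N :: "real^'n^'n"
  shows "transpose M \<bullet> transpose N = M \<bullet> N"
  unfolding inner_vec_def inner_real_def transpose_def by (simp, rule sum.swap)

text \<open>With \<open>M\<close> frozen at \<open>p\<close>, subtracting
  \<open>M \<bullet> (q ** transpose q)\<close> leaves a function of \<open>q\<close> with quadratic
  error at \<open>p\<close>. The derivative is therefore that of an explicit quadratic form.\<close>

lemma has_derivative_sum_sigmas:
  fixes f g g' :: "real \<Rightarrow> real" and p :: "real^'n^'n"
  assumes f: "\<And>x. (f has_real_derivative g x) (at x)" and g: "\<And>x. (g has_real_derivative g' x) (at x)"
    and c: "continuous_on UNIV g'"
  shows "((\<lambda>p. \<Sum>s\<in>#sigmas p. f s) has_derivative (\<lambda>h. (2 *\<^sub>R (mfun g (p ** transpose p) ** p)) \<bullet> h)) (at p)"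
proof -
  let ?F = "\<lambda>p :: real^'n^'n. \<Sum>s\<in>#sigmas p. f s"
  define M where "M = mfun g (p ** transpose p)"
  define R where "R = norm p + 1"
  have pR: "p \<in> ball 0 R" by (simp add: R_def)
  obtain K where K: "K \<ge> 0" "\<And>p q :: real^'n^'n. p \<in> ball 0 R \<Longrightarrow> q \<in> ball 0 R \<Longrightarrow>
      norm (p ** transpose p - q ** transpose q) \<le> K * norm (p - q)"
    using mult_transpose_Lipschitz by blast
  obtain C where C: "C \<ge> 0" "\<And>x y. x \<in> {0..R\<^sup>2} \<Longrightarrow> y \<in> {0..R\<^sup>2} \<Longrightarrow>
      \<bar>f y - f x - g x * (y - x)\<bar> \<le> C * (y - x)\<^sup>2"
    using taylor_quadratic_bound[OF f g c] by blast
  have bound: "\<bar>?F q - ?F p - M \<bullet> (q ** transpose q - p ** transpose p)\<bar> \<le> (C * K\<^sup>2) * (norm (q - p))\<^sup>2"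
    if q: "q \<in> ball 0 R" for q
  proof -
    obtain a l where a: "eigsys (p ** transpose p) a l" using symmetric_matrix_eigsys[OF transpose_mult_transpose] .
    obtain b m where b: "eigsys (q ** transpose q) b m" using symmetric_matrix_eigsys[OF transpose_mult_transpose] .
    have "(norm p)\<^sup>2 \<le> R\<^sup>2" "(norm q)\<^sup>2 \<le> R\<^sup>2" using pR q by (auto intro: power_mono)
    then have lm: "l i \<in> {0..R\<^sup>2}" "m i \<in> {0..R\<^sup>2}" for i
      using eigenvalue_mult_transpose_bounds[OF a, of i] eigenvalue_mult_transpose_bounds[OF b, of i] by auto
    have "\<bar>?F q - ?F p - M \<bullet> (q ** transpose q - p ** transpose p)\<bar> \<le> C * (norm (q ** transpose q - p ** transpose p))\<^sup>2"
      unfolding sum_sigmas_eigsys[OF a] sum_sigmas_eigsys[OF b] M_def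
      by (rule trace_function_taylor_bound[OF transpose_mult_transpose transpose_mult_transpose a b lm C(2)])
    also have "\<dots> \<le> C * (K * norm (q - p))\<^sup>2"
      by (intro mult_left_mono power_mono K q pR C) auto
    finally show ?thesis by (simp add: power_mult_distrib mult.assoc)
  qed
  have "((\<lambda>q. ?F q - M \<bullet> (q ** transpose q)) has_derivative (\<lambda>h. 0)) (at p)"
  proof (rule has_derivative_zero_quadratic[OF open_ball pR])
    show "\<bar>?F q - M \<bullet> (q ** transpose q) - (?F p - M \<bullet> (p ** transpose p))\<bar> \<le> (C * K\<^sup>2) * (norm (q - p))\<^sup>2"
      if "q \<in> ball 0 R" for q
      using bound[OF that] by (simp add: inner_diff_right algebra_simps)
  qed (use C(1) in simp)
  moreover have "((\<lambda>q :: real^'n^'n. q ** transpose q) has_derivative (\<lambda>h. p ** transpose h + h ** transpose p)) (at p)"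
    by (intro bounded_bilinear.FDERIV[OF bounded_bilinear_matrix_mult] has_derivative_ident
        bounded_linear_imp_has_derivative bounded_linear_transpose)
  then have "((\<lambda>q. M \<bullet> (q ** transpose q)) has_derivative (\<lambda>h. M \<bullet> (p ** transpose h + h ** transpose p))) (at p)"
    by (rule has_derivative_inner_right)
  ultimately have "((\<lambda>q. (?F q - M \<bullet> (q ** transpose q)) + M \<bullet> (q ** transpose q)) has_derivative
      (\<lambda>h. 0 + M \<bullet> (p ** transpose h + h ** transpose p))) (at p)"
    by (rule has_derivative_add)
  \<comment> \<open>The two terms coincide because \<open>M\<close> is symmetric, whence the factor
    2.\<close>
  moreover have "M \<bullet> (p ** transpose h + h ** transpose p) = (2 *\<^sub>R (M ** p)) \<bullet> h" for h
  proof -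
    have "M \<bullet> (p ** transpose h) = transpose M \<bullet> transpose (p ** transpose h)" by (simp only: inner_transpose)
    also have "\<dots> = M \<bullet> (h ** transpose p)"
      by (simp add: M_def transpose_mfun[OF transpose_mult_transpose] matrix_transpose_mul)
    finally show ?thesis by (simp add: inner_add_right inner_matrix_mult_transpose)
  qed
  ultimately show ?thesis by (simp add: M_def)
qed

theorem C2_sum_sigmas:
  fixes f g g' :: "real \<Rightarrow> real"
  assumes f: "\<And>x. (f has_real_derivative g x) (at x)" and g: "\<And>x. (g has_real_derivative g' x) (at x)"
    and c: "continuous_on UNIV g'"
  shows "C2_on_UNIV (\<lambda>p :: real^'n^'n. \<Sum>s\<in>#sigmas p. f s)"
proof (rule C2_on_UNIV_gradient[OF has_derivative_sum_sigmas[OF f g c]])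
  have "C1_map (\<lambda>p :: real^'n^'n. mfun g (p ** transpose p) ** p)"
    by (rule C1_map_bilinear[OF bounded_bilinear_matrix_mult C1_map_mfun[OF g c]
        C1_map_bounded_linear[OF bounded_linear_ident]])
  then show "C1_map (\<lambda>p :: real^'n^'n. 2 *\<^sub>R (mfun g (p ** transpose p) ** p))"
    by (rule C1_map_bilinear[OF bounded_bilinear_scaleR C1_map_const])
qed

section \<open>Convexity of spectral functions\<close>

text \<open>\<open>x\<close> is a convex combination of \<open>- y\<close> and \<open>y\<close>,
  where \<open>h\<close> takes the same value.\<close>

lemma convex_even_mono:
  fixes h :: "real \<Rightarrow> real"
  assumes h: "convex_on UNIV h" and even: "\<And>x. h (- x) = h x" and xy: "\<bar>x\<bar> \<le> y"
  shows "h x \<le> h y"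
proof (cases "y = 0")
  case False
  define t where "t = (x + y) / (2 * y)"
  have y: "y > 0" using False xy by linarith
  have t: "0 \<le> t" "t \<le> 1" using y xy by (auto simp: t_def field_simps)
  have "x = (1 - t) *\<^sub>R (- y) + t *\<^sub>R y" using y by (simp add: t_def field_simps)
  then have "h x \<le> (1 - t) * h (- y) + t * h y"
    using convex_onD[OF h t, of "- y" y] by simp
  then show ?thesis by (simp add: even algebra_simps)
qed (use xy in auto)

text \<open>Jensen's inequality with the missing weight placed at the point 0; the additional index
  \<open>None\<close> carries it.\<close>

lemma convex_on_substochastic_sum:
  fixes h :: "real \<Rightarrow> real" and w s :: "'n::finite \<Rightarrow> real"
  assumes h: "convex_on UNIV h" and w: "\<And>j. w j \<ge> 0" "(\<Sum>j\<in>UNIV. w j) \<le> 1"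
  shows "h (\<Sum>j\<in>UNIV. w j * s j) - h 0 \<le> (\<Sum>j\<in>UNIV. w j * (h (s j) - h 0))"
proof -
  define c where "c = case_option (1 - (\<Sum>j\<in>UNIV. w j)) w"
  define y where "y = case_option 0 s"
  have split: "(\<Sum>i\<in>UNIV. k i) = k None + (\<Sum>j\<in>UNIV. k (Some j))" for k :: "'n option \<Rightarrow> real"
    by (simp add: UNIV_option_conv sum.reindex)
  have "h (\<Sum>i\<in>UNIV. c i *\<^sub>R y i) \<le> (\<Sum>i\<in>UNIV. c i * h (y i))"
    by (rule convex_on_sum[OF _ _ h]) (use w in \<open>auto simp: c_def split split: option.split\<close>)
  then show ?thesis
    by (simp add: split c_def y_def right_diff_distrib sum_subtractf left_diff_distrib sum_distrib_right)
qed

text \<open>Zero vectors are allowed so that the right singular vectors belonging to the singular value 0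
  need not be completed to a basis; \<open>right_singular\<close> gives 0 for them since division by 0 yields 0.\<close>

definition suborthonormal :: "('n \<Rightarrow> real^'n) \<Rightarrow> bool" where
  "suborthonormal v \<longleftrightarrow> (\<forall>i j. i \<noteq> j \<longrightarrow> v i \<bullet> v j = 0) \<and> (\<forall>i. norm (v i) \<le> 1)"

text \<open>As the \<open>v i\<close> may be shorter than 1, \<open>y\<close> need not be the
  orthogonal projection of \<open>x\<close>. The inequality
  \<open>y \<bullet> y \<le> y \<bullet> x\<close> survives and suffices, by expanding the square of
  \<open>x - y\<close>.\<close>

lemma suborthonormal_bessel:
  assumes "suborthonormal v"
  shows "(\<Sum>i\<in>UNIV. (v i \<bullet> x)\<^sup>2) \<le> (norm x)\<^sup>2"
proof -
  define y where "y = (\<Sum>i\<in>UNIV. (v i \<bullet> x) *\<^sub>R v i)"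
  have xy: "y \<bullet> x = (\<Sum>i\<in>UNIV. (v i \<bullet> x)\<^sup>2)"
    by (simp add: y_def inner_sum_left power2_eq_square)
  have vy: "v i \<bullet> y = (v i \<bullet> x) * (v i \<bullet> v i)" for i
  proof -
    have "v i \<bullet> y = (\<Sum>j\<in>UNIV. if j = i then (v i \<bullet> x) * (v i \<bullet> v i) else 0)"
      unfolding y_def inner_sum_right using assms by (intro sum.cong) (auto simp: suborthonormal_def)
    then show ?thesis by simp
  qed
  have "y \<bullet> y = (\<Sum>i\<in>UNIV. (v i \<bullet> x) * (v i \<bullet> y))"
    by (subst (1) y_def) (simp add: inner_sum_left)
  also have "\<dots> \<le> (\<Sum>i\<in>UNIV. (v i \<bullet> x)\<^sup>2)"
  proof (rule sum_mono)
    fix i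
    have "v i \<bullet> v i \<le> 1"
      using assms by (simp add: suborthonormal_def power2_norm_eq_inner[symmetric] power_le_one)
    then show "(v i \<bullet> x) * (v i \<bullet> y) \<le> (v i \<bullet> x)\<^sup>2"
      using mult_left_mono[of "v i \<bullet> v i" 1 "(v i \<bullet> x)\<^sup>2"] by (simp add: vy power2_eq_square mult_ac)
  qed
  finally have "y \<bullet> y \<le> y \<bullet> x" by (simp add: xy)
  moreover have "0 \<le> (x - y) \<bullet> (x - y)" by simp
  ultimately have "y \<bullet> x \<le> x \<bullet> x" by (simp add: inner_diff_left inner_diff_right inner_commute)
  then show ?thesis by (simp add: xy power2_norm_eq_inner)
qed

definition right_singular :: "real^'n^'n \<Rightarrow> ('n \<Rightarrow> real^'n) \<Rightarrow> ('n \<Rightarrow> real) \<Rightarrow> 'n \<Rightarrow> real^'n" where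
  "right_singular p a l i = (a i v* p) /\<^sub>R sqrt (l i)"

text \<open>For \<open>l i = 0\<close> both sides vanish, since \<open>l i\<close> is the squared
  norm of the left side.\<close>

lemma right_singular_scale:
  assumes "eigsys (p ** transpose p) a l"
  shows "a i v* p = sqrt (l i) *\<^sub>R right_singular p a l i"
  by (cases "l i = 0") (use eigenvalue_mult_transpose(1)[OF assms, of i] in \<open>auto simp: right_singular_def\<close>)

lemma suborthonormal_right_singular:
  assumes "eigsys (p ** transpose p) a l"
  shows "suborthonormal (right_singular p a l)"
  using eigenvalue_mult_transpose[OF assms]
  by (auto simp: suborthonormal_def right_singular_def inverse_eq_divide)

text \<open>Expand \<open>u i \<bullet> (p *v v i)\<close> in the singular vectors of
  \<open>p\<close>. The coefficients of the singular values are dominated by a doubly substochastic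
  matrix, so monotonicity and Jensen's inequality for \<open>h\<close> bound the sum.\<close>

lemma sum_sigmas_variational_bound:
  fixes p :: "real^'n^'n" and f :: "real \<Rightarrow> real"
  assumes h: "convex_on UNIV (\<lambda>t. f (t\<^sup>2))" and u: "onb u" and v: "suborthonormal v"
  shows "(\<Sum>i\<in>UNIV. f ((u i \<bullet> (p *v v i))\<^sup>2)) \<le> (\<Sum>s\<in>#sigmas p. f s)"
proof -
  obtain a l where e: "eigsys (p ** transpose p) a l"
    using symmetric_matrix_eigsys[OF transpose_mult_transpose] .
  have a: "onb a" using e by (simp add: eigsys_def)
  define b where "b = right_singular p a l"
  have b: "suborthonormal b" unfolding b_def by (rule suborthonormal_right_singular[OF e])
  have l0: "l j \<ge> 0" for j using eigenvalue_mult_transpose_bounds[OF e, of j] by simp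
  define h where "h t = f (t\<^sup>2)" for t
  have hc: "convex_on UNIV h" using h by (simp add: h_def[abs_def])
  have he: "h (- t) = h t" for t by (simp add: h_def)
  \<comment> \<open>The arithmetic-geometric mean inequality makes this average dominate the product
    of the two inner products; Parseval and Bessel bound its row and column sums by 1.\<close>
  define w where "w i j = ((u i \<bullet> a j)\<^sup>2 + (b j \<bullet> v i)\<^sup>2) / 2" for i j
  have w0: "w i j \<ge> 0" for i j by (simp add: w_def)
  have nv: "(norm (v i))\<^sup>2 \<le> 1" and nb: "(norm (b i))\<^sup>2 \<le> 1" for i
    using v b by (auto simp: suborthonormal_def power_le_one)
  have nu: "(norm (u i))\<^sup>2 = 1" and na: "(norm (a i))\<^sup>2 = 1" for i
    using u a by (auto simp: onb_def power2_norm_eq_inner)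
  have row: "(\<Sum>j\<in>UNIV. w i j) \<le> 1" for i
    using onb_parseval[OF a, of "u i"] suborthonormal_bessel[OF b, of "v i"] nv[of i] nu[of i]
    by (simp add: w_def sum_divide_distrib[symmetric] sum.distrib inner_commute)
  have col: "(\<Sum>i\<in>UNIV. w i j) \<le> 1" for j
    using onb_parseval[OF u, of "a j"] suborthonormal_bessel[OF v, of "b j"] nb[of j] na[of j]
    by (simp add: w_def sum_divide_distrib[symmetric] sum.distrib inner_commute)
  have "h (u i \<bullet> (p *v v i)) - h 0 \<le> (\<Sum>j\<in>UNIV. w i j * (h (sqrt (l j)) - h 0))" for i
  proof -
    have "u i \<bullet> (p *v v i) = (\<Sum>j\<in>UNIV. (a j \<bullet> u i) * (a j \<bullet> (p *v v i)))"
      by (rule onb_parseval_inner[OF a, symmetric])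
    also have "\<dots> = (\<Sum>j\<in>UNIV. (u i \<bullet> a j) * (b j \<bullet> v i) * sqrt (l j))"
      by (simp add: dot_lmul_matrix[symmetric] right_singular_scale[OF e] b_def inner_commute mult_ac)
    also have "\<bar>\<dots>\<bar> \<le> (\<Sum>j\<in>UNIV. w i j * sqrt (l j))"
    proof (intro sum_abs[THEN order_trans] sum_mono)
      fix j
      have "\<bar>(u i \<bullet> a j) * (b j \<bullet> v i)\<bar> \<le> w i j"
        using sum_squares_bound[of "\<bar>u i \<bullet> a j\<bar>" "\<bar>b j \<bullet> v i\<bar>"] by (simp add: w_def abs_mult)
      then show "\<bar>(u i \<bullet> a j) * (b j \<bullet> v i) * sqrt (l j)\<bar> \<le> w i j * sqrt (l j)"
        using l0[of j] by (simp add: abs_mult mult_right_mono)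
    qed
    finally have "h (u i \<bullet> (p *v v i)) \<le> h (\<Sum>j\<in>UNIV. w i j * sqrt (l j))"
      by (rule convex_even_mono[OF hc he])
    then show ?thesis
      using convex_on_substochastic_sum[OF hc w0 row, of i "\<lambda>j. sqrt (l j)"] by linarith
  qed
  then have "(\<Sum>i\<in>UNIV. h (u i \<bullet> (p *v v i)) - h 0) \<le> (\<Sum>i\<in>UNIV. \<Sum>j\<in>UNIV. w i j * (h (sqrt (l j)) - h 0))"
    by (rule sum_mono)
  also have "\<dots> = (\<Sum>j\<in>UNIV. (\<Sum>i\<in>UNIV. w i j) * (h (sqrt (l j)) - h 0))"
    by (subst sum.swap) (simp add: sum_distrib_right)
  \<comment> \<open>Raising the column sums to 1 requires nonnegative factors, which is why
    \<open>h 0\<close>, the minimum of \<open>h\<close>, has been subtracted. It occurs equally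
    often on both sides and cancels.\<close>
  also have "\<dots> \<le> (\<Sum>j\<in>UNIV. 1 * (h (sqrt (l j)) - h 0))"
    using convex_even_mono[OF hc he, of 0 "sqrt (l _)"] l0 by (intro sum_mono mult_right_mono col) auto
  finally have "(\<Sum>i\<in>UNIV. h (u i \<bullet> (p *v v i))) \<le> (\<Sum>j\<in>UNIV. h (sqrt (l j)))"
    by (simp add: sum_subtractf)
  then show ?thesis using l0 by (simp add: sum_sigmas_eigsys[OF e] h_def)
qed

lemma sum_sigmas_variational_attained:
  fixes p :: "real^'n^'n" and f :: "real \<Rightarrow> real"
  obtains u v where "onb u" "suborthonormal v"
    "(\<Sum>s\<in>#sigmas p. f s) = (\<Sum>i\<in>UNIV. f ((u i \<bullet> (p *v v i))\<^sup>2))"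
proof -
  obtain a l where e: "eigsys (p ** transpose p) a l"
    using symmetric_matrix_eigsys[OF transpose_mult_transpose] .
  \<comment> \<open>Singular vectors turn each diagonal entry into a singular value; for
    \<open>l i = 0\<close> the right vector is 0 and so is the entry.\<close>
  have "(a i \<bullet> (p *v right_singular p a l i))\<^sup>2 = l i" for i
  proof -
    have l0: "l i \<ge> 0" using eigenvalue_mult_transpose_bounds[OF e, of i] by simp
    have "a i \<bullet> (p *v right_singular p a l i) = (a i v* p) \<bullet> (a i v* p) / sqrt (l i)"
      by (simp add: dot_lmul_matrix[symmetric] right_singular_def divide_inverse)
    also have "\<dots> = sqrt (l i)" using eigenvalue_mult_transpose(2)[OF e, of i i] l0 by (simp add: real_div_sqrt)
    finally show ?thesis using l0 by simp
  qed
  then have "(\<Sum>s\<in>#sigmas p. f s) = (\<Sum>i\<in>UNIV. f ((a i \<bullet> (p *v right_singular p a l i))\<^sup>2))"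
    by (simp add: sum_sigmas_eigsys[OF e])
  moreover have "onb a" using e by (simp add: eigsys_def)
  ultimately show thesis using that suborthonormal_right_singular[OF e] by blast
qed

text \<open>The bases attaining the value at the intermediate matrix \<open>r\<close> are admissible
  competitors for \<open>p\<close> and \<open>q\<close>, as for any maximum of convex
  functions.\<close>

theorem convex_on_sum_sigmas:
  fixes f :: "real \<Rightarrow> real"
  assumes h: "convex_on UNIV (\<lambda>t. f (t\<^sup>2))"
  shows "convex_on UNIV (\<lambda>p :: real^'n^'n. \<Sum>s\<in>#sigmas p. f s)"
proof (rule convex_onI)
  fix t :: real and p q :: "real^'n^'n" assume t: "0 < t" "t < 1"
  let ?F = "\<lambda>p :: real^'n^'n. \<Sum>s\<in>#sigmas p. f s"
  define r where "r = (1 - t) *\<^sub>R p + t *\<^sub>R q"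
  obtain u v where uv: "onb u" "suborthonormal v"
    and r: "?F r = (\<Sum>i\<in>UNIV. f ((u i \<bullet> (r *v v i))\<^sup>2))"
    using sum_sigmas_variational_attained .
  have "f ((u i \<bullet> (r *v v i))\<^sup>2) \<le> (1 - t) * f ((u i \<bullet> (p *v v i))\<^sup>2) + t * f ((u i \<bullet> (q *v v i))\<^sup>2)" for i
  proof -
    have "u i \<bullet> (r *v v i) = (1 - t) *\<^sub>R (u i \<bullet> (p *v v i)) + t *\<^sub>R (u i \<bullet> (q *v v i))"
      by (simp add: r_def matrix_vector_mult_add_rdistrib scaleR_matrix_vector_assoc[symmetric] inner_add_right)
    then show ?thesis using convex_onD[OF h, of t] t by simp
  qed
  then have "?F r \<le> (\<Sum>i\<in>UNIV. (1 - t) * f ((u i \<bullet> (p *v v i))\<^sup>2) + t * f ((u i \<bullet> (q *v v i))\<^sup>2))"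
    unfolding r by (rule sum_mono)
  also have "\<dots> = (1 - t) * (\<Sum>i\<in>UNIV. f ((u i \<bullet> (p *v v i))\<^sup>2)) + t * (\<Sum>i\<in>UNIV. f ((u i \<bullet> (q *v v i))\<^sup>2))"
    by (simp add: sum.distrib sum_distrib_left)
  also have "\<dots> \<le> (1 - t) * ?F p + t * ?F q"
    using t by (intro add_mono mult_left_mono sum_sigmas_variational_bound[OF h uv]) auto
  finally show "?F ((1 - t) *\<^sub>R p + t *\<^sub>R q) \<le> (1 - t) * ?F p + t * ?F q" by (simp only: r_def)
qed simp

section \<open>The scalar function: convexity in the singular value and regularity\<close>

lemma convex_root4:
  fixes c :: real
  assumes c: "c > 0"
  shows "convex_on UNIV (\<lambda>t. root 4 (c + t ^ 4))"
proof -
  have pos: "c + t ^ 4 > 0" for t :: real using c by (simp add: add_pos_nonneg)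
  have eq: "root 4 (c + t ^ 4) = (c + t ^ 4) powr (1/4)" for t
    using root_powr_inverse[of 4 "c + t ^ 4"] pos[of t] by simp
  have "convex_on UNIV (\<lambda>t. (c + t ^ 4) powr (1/4))"
  proof (rule f''_ge0_imp_convex)
    fix t :: real
    show "((\<lambda>t. (c + t ^ 4) powr (1/4)) has_real_derivative t ^ 3 * (c + t ^ 4) powr (- 3/4)) (at t)"
      using pos[of t] by (auto intro!: derivative_eq_intros)
    show "((\<lambda>t. t ^ 3 * (c + t ^ 4) powr (- 3/4)) has_real_derivative
        3 * t\<^sup>2 * (c + t ^ 4) powr (- 3/4) - 3 * t ^ 6 * (c + t ^ 4) powr (- 7/4)) (at t)"
      using pos[of t] by (auto intro!: derivative_eq_intros simp: power_numeral_reduce)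
    \<comment> \<open>Splitting off one factor \<open>c + t ^ 4\<close> gives both terms the same
      power; the \<open>t ^ 6\<close> parts cancel and a nonnegative multiple of \<open>c\<close>
      remains.\<close>
    have "(c + t ^ 4) powr (- 3/4) = (c + t ^ 4) powr (1 + (- 7/4))" by simp
    also have "\<dots> = (c + t ^ 4) * (c + t ^ 4) powr (- 7/4)"
      using pos[of t] by (simp only: powr_add) simp
    finally have "3 * t\<^sup>2 * (c + t ^ 4) powr (- 3/4) - 3 * t ^ 6 * (c + t ^ 4) powr (- 7/4)
        = 3 * t\<^sup>2 * c * (c + t ^ 4) powr (- 7/4)"
      by (simp add: algebra_simps power_numeral_reduce)
    also have "\<dots> \<ge> 0" using c by simp
    finally show "3 * t\<^sup>2 * (c + t ^ 4) powr (- 3/4) - 3 * t ^ 6 * (c + t ^ 4) powr (- 7/4) \<ge> 0" .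
  qed simp
  then show ?thesis by (simp add: eq)
qed

text \<open>An even convex function is increasing only on the nonnegative half-line, so the inner
  function has to be nonnegative.\<close>

lemma convex_even_compose:
  fixes \<psi> \<kappa> :: "real \<Rightarrow> real"
  assumes psi: "convex_on UNIV \<psi>" "\<And>y. \<psi> (- y) = \<psi> y" and k: "convex_on UNIV \<kappa>" "\<And>t. \<kappa> t \<ge> 0"
  shows "convex_on UNIV (\<lambda>t. \<psi> (\<kappa> t))"
proof (rule convex_onI)
  fix t x y :: real assume t: "0 < t" "t < 1"
  have "\<bar>\<kappa> ((1 - t) *\<^sub>R x + t *\<^sub>R y)\<bar> \<le> (1 - t) * \<kappa> x + t * \<kappa> y"
    using convex_onD[OF k(1), of t x y] k(2) t by simp
  then have "\<psi> (\<kappa> ((1 - t) *\<^sub>R x + t *\<^sub>R y)) \<le> \<psi> ((1 - t) * \<kappa> x + t * \<kappa> y)"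
    by (rule convex_even_mono[OF psi])
  also have "\<dots> \<le> (1 - t) * \<psi> (\<kappa> x) + t * \<psi> (\<kappa> y)"
    using convex_onD[OF psi(1), of t "\<kappa> x" "\<kappa> y"] t by simp
  finally show "\<psi> (\<kappa> ((1 - t) *\<^sub>R x + t *\<^sub>R y)) \<le> (1 - t) * \<psi> (\<kappa> x) + t * \<psi> (\<kappa> y)" .
qed simp

text \<open>Positivity of \<open>c\<close> keeps the radicand away from 0, where the root is not
  smooth; \<open>powr\<close> then gives explicit derivatives for the chain rule.\<close>

lemma C2_compose_root4:
  fixes \<psi> \<psi>1 \<psi>2 :: "real \<Rightarrow> real" and c :: real
  assumes c: "c > 0" and d1: "\<And>y. (\<psi> has_real_derivative \<psi>1 y) (at y)"
    and d2: "\<And>y. (\<psi>1 has_real_derivative \<psi>2 y) (at y)" and cont2: "continuous_on UNIV \<psi>2"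
  obtains g g' where "\<And>s. ((\<lambda>s. \<psi> (root 4 (c + s\<^sup>2))) has_real_derivative g s) (at s)"
    "\<And>s. (g has_real_derivative g' s) (at s)" "continuous_on UNIV g'"
proof -
  have pos: "c + s\<^sup>2 > 0" for s :: real using c by (simp add: add_pos_nonneg)
  define \<rho> where "\<rho> s = (c + s\<^sup>2) powr (1/4)" for s :: real
  define \<rho>1 where "\<rho>1 s = s / 2 * (c + s\<^sup>2) powr (- 3/4)" for s :: real
  define \<rho>2 where "\<rho>2 s = (c + s\<^sup>2) powr (- 3/4) / 2 - 3/4 * s\<^sup>2 * (c + s\<^sup>2) powr (- 7/4)" for s :: real
  have eq: "root 4 (c + s\<^sup>2) = \<rho> s" for s
    using root_powr_inverse[of 4 "c + s\<^sup>2"] pos[of s] by (simp add: \<rho>_def)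
  have r1: "(\<rho> has_real_derivative \<rho>1 s) (at s)" for s
    unfolding \<rho>_def[abs_def] \<rho>1_def using pos[of s] by (auto intro!: derivative_eq_intros)
  have r2: "(\<rho>1 has_real_derivative \<rho>2 s) (at s)" for s
    unfolding \<rho>1_def[abs_def] \<rho>2_def using pos[of s]
    by (auto intro!: derivative_eq_intros simp: power2_eq_square)
  have c0: "continuous_on UNIV \<rho>" "continuous_on UNIV \<rho>1" "continuous_on UNIV \<psi>1"
    using r1 r2 d2 by (meson DERIV_continuous_on has_field_derivative_at_within)+
  have c2: "continuous_on UNIV \<rho>2"
    unfolding \<rho>2_def[abs_def] using pos by (auto intro!: continuous_intros simp: less_imp_neq[symmetric])
  show thesis
  proof (rule that[of "\<lambda>s. \<psi>1 (\<rho> s) * \<rho>1 s" "\<lambda>s. \<psi>2 (\<rho> s) * \<rho>1 s * \<rho>1 s + \<rho>2 s * \<psi>1 (\<rho> s)"])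
    fix s
    show "((\<lambda>s. \<psi> (root 4 (c + s\<^sup>2))) has_real_derivative \<psi>1 (\<rho> s) * \<rho>1 s) (at s)"
      unfolding eq by (rule DERIV_chain2[OF d1 r1])
    show "((\<lambda>s. \<psi>1 (\<rho> s) * \<rho>1 s) has_real_derivative \<psi>2 (\<rho> s) * \<rho>1 s * \<rho>1 s + \<rho>2 s * \<psi>1 (\<rho> s)) (at s)"
      by (rule DERIV_mult[OF DERIV_chain2[OF d2 r1] r2])
  next
    show "continuous_on UNIV (\<lambda>s. \<psi>2 (\<rho> s) * \<rho>1 s * \<rho>1 s + \<rho>2 s * \<psi>1 (\<rho> s))"
      by (intro continuous_intros c0 c2 continuous_on_compose2[OF cont2 c0(1)]
          continuous_on_compose2[OF c0(3) c0(1)]) auto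
  qed
qed

theorem theorem4p1:
  fixes \<psi> \<psi>1 \<psi>2 :: "real \<Rightarrow> real"
    and \<epsilon> \<nu>1 \<nu>2 \<nu>3 :: real
  assumes eps: "\<epsilon> > 0"
    and nonneg: "\<And>y. \<psi> y \<ge> 0"
    and d1: "\<And>y. (\<psi> has_real_derivative \<psi>1 y) (at y)"
    and d2: "\<And>y. (\<psi>1 has_real_derivative \<psi>2 y) (at y)"
    and cont2: "continuous_on UNIV \<psi>2"
    and even: "\<And>y. \<psi> (- y) = \<psi> y"
    and zero: "\<psi> 0 = 0"
    and nu1: "\<nu>1 > 0" and nu2: "\<nu>2 > 0"
    and bound1: "\<And>y. \<bar>\<psi>1 y\<bar> \<le> \<nu>1"
    and growth: "\<And>y. \<psi> y \<ge> \<nu>2 * \<bar>y\<bar> - \<nu>3"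
    and convex2: "\<And>y. \<psi>2 y > 0"
  shows "convex_on UNIV (Fstar \<psi> \<epsilon> :: real^'n^'n \<Rightarrow> real) \<and>
         C2_on_UNIV (Fstar \<psi> \<epsilon> :: real^'n^'n \<Rightarrow> real)"
proof -
  define f where "f s = \<psi> (root 4 (\<epsilon>\<^sup>2 + s\<^sup>2))" for s
  have F: "(Fstar \<psi> \<epsilon> :: real^'n^'n \<Rightarrow> real) = (\<lambda>p. \<Sum>s\<in>#sigmas p. f s)"
    by (simp add: fun_eq_iff Fstar_def f_def)
  have e: "\<epsilon>\<^sup>2 > 0" using eps by simp
  have "convex_on UNIV \<psi>"
    by (rule f''_ge0_imp_convex[OF convex_UNIV d1 d2]) (simp add: convex2 less_imp_le)
  then have "convex_on UNIV (\<lambda>t. \<psi> (root 4 (\<epsilon>\<^sup>2 + t ^ 4)))"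
    by (rule convex_even_compose[where \<psi> = \<psi>]) (simp_all add: even convex_root4[OF e])
  \<comment> \<open>With \<open>t\<close> a singular value, the eigenvalue is
    \<open>t\<^sup>2\<close> and its square \<open>t ^ 4\<close>.\<close>
  then have "convex_on UNIV (\<lambda>t. f (t\<^sup>2))" by (simp add: f_def)
  then have "convex_on UNIV (Fstar \<psi> \<epsilon> :: real^'n^'n \<Rightarrow> real)"
    unfolding F by (rule convex_on_sum_sigmas)
  moreover obtain g g' where "\<And>s. (f has_real_derivative g s) (at s)"
    "\<And>s. (g has_real_derivative g' s) (at s)" "continuous_on UNIV g'"
    using C2_compose_root4[OF e d1 d2 cont2] unfolding f_def[abs_def] by blast
  then have "C2_on_UNIV (Fstar \<psi> \<epsilon> :: real^'n^'n \<Rightarrow> real)"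
    unfolding F by (rule C2_sum_sigmas)
  ultimately show ?thesis ..
qed

end
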